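(* Let $\rho=(\rho_0,\rho_1,\rho_2,\rho_3)$ be a probability vector on $\{0,1,2,3\}$ and let $t\in[0,1]$ with $t<\bar t_c(\rho)$, where $$\bar t_c(\rho)=\sup\{s\in[0,1]:\mathbb{E}_{\rho,s}(|C|)<\infty\}.$$ Let $\theta_n(t)$ denote the $\mathbb{P}_{\rho,t}$-probability that the origin is connected to $\partial B(n)$ by an open path. Then there exists $\alpha>0$ such that $$\theta_n(t)\leq e^{-\alpha n}\quad\text{for all } n.$$
   Context: Let $\mathbb{L}^2=(\mathbb{Z}^2,\mathcal{E})$ be the square lattice with nearest-neighbour edges. Constrained-degree percolation in random environment (CDPRE). Let $\rho=(\rho_0,\rho_1,\rho_2,\rho_3)$ be a probability vector. Let $\kappa=\{\kappa_v\}_{v\in\mathbb{Z}^2}$ be i.i.d. with $\kappa_v=j$ with probability $\rho_j$, $j\in\{0,1,2,3\}$ (law $\mathbb{P}_\rho$), and, independently, let $U=\{U_e\}_{e\in\mathcal{E}}$ be i.i.d. uniform on $(0,1]$ (law $\mathbb{P}$). At time $0$ all edges are closed. Each edge $e=\langle u,v\rangle$ attempts to open at time $U_e$; it succeeds if and only if, immediately before time $U_e$, the number of open edges incident to $u$ is strictly less than $\kappa_u$ and the number of open edges incident to $v$ is strictly less than $\kappa_v$. An edge that opens stays open forever; an edge that fails stays closed forever. For almost every $(\kappa,U)$ this determines, for every $t\in[0,1]$, a configuration $\omega_t=\omega_t(\kappa,U)\in\{0,1\}^{\mathcal{E}}$, where $\omega_{t,e}=1$ if $e$ is open at time $t$ (i.e.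 $U_e\le t$ and the attempt of $e$ succeeded) and $\omega_{t,e}=0$ otherwise. Let $\mathbb{P}_{\rho,t}$ be the law of $\omega_t$ on $\{0,1\}^{\mathcal{E}}$, i.e. $\mathbb{P}_{\rho,t}(A)=(\mathbb{P}_\rho\times\mathbb{P})(\omega_t^{-1}(A))$, and $\mathbb{E}_{\rho,t}$ the corresponding expectation. $C$ denotes the open cluster of the origin: the set of vertices connected to the origin by a path of open edges. $B(n)=[-n,n]^2\cap\mathbb{Z}^2$, and $\partial B(n)$ is the set of vertices of $B(n)$ adjacent to some vertex not in $B(n)$. *)

theory Defs
  imports "HOL-Probability.Probability"
begin

type_synonym vertex = "int \<times> int"
type_synonym edge = "vertex set"

definition edges :: "edge set" where
  "edges = {{u, v} | u v :: vertex. \<bar>fst u - fst v\<bar> + \<bar>snd u - snd v\<bar> = 1}"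

text \<open>
  \<^term>\<open>S\<close> is the set of edges whose attempt succeeds. Immediately before time \<open>U e\<close>, the open
  edges at a vertex are the successful incident edges \<open>f\<close> with \<open>U f < U e\<close>.
\<close>

definition cdp_dynamics :: "(vertex \<Rightarrow> nat) \<Rightarrow> (edge \<Rightarrow> real) \<Rightarrow> edge set \<Rightarrow> bool" where
  "cdp_dynamics \<kappa> U S \<longleftrightarrow> S \<subseteq> edges \<and>
     (\<forall>e\<in>edges. e \<in> S \<longleftrightarrow> (\<forall>v\<in>e. card {f \<in> S. v \<in> f \<and> U f < U e} < \<kappa> v))"

text \<open>
  The attempt of an edge depends only on the adjacent edges with smaller clock value. When this
  relation is well-founded the dynamics has exactly one solution (lemma below). This happens for
  almost every \<open>U\<close>: a chain of \<open>n + 1\<close> successively adjacent, distinct edges has decreasing clocks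
  with probability \<open>1 / (n + 1)!\<close>, and at most \<open>6 ^ n\<close> such chains start at a given edge. On the
  remaining null set all edges are declared closed; testing well-foundedness, rather than leaving
  the value unspecified, keeps the configuration measurable in \<open>(\<kappa>, U)\<close>.
\<close>

definition earlier_adjacent :: "(edge \<Rightarrow> real) \<Rightarrow> (edge \<times> edge) set" where
  "earlier_adjacent U = {(f, e). f \<in> edges \<and> e \<in> edges \<and> f \<inter> e \<noteq> {} \<and> U f < U e}"

definition successful :: "(vertex \<Rightarrow> nat) \<Rightarrow> (edge \<Rightarrow> real) \<Rightarrow> edge set" where
  "successful \<kappa> U =
     (if wf (earlier_adjacent U) then THE S. cdp_dynamics \<kappa> U S else {})"

lemma cdp_dynamics_ex1:
  assumes wf: "wf (earlier_adjacent U)"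
  shows "\<exists>!S. cdp_dynamics \<kappa> U S"
proof (rule ex_ex1I)
  define F where "F = (\<lambda>g e. e \<in> edges \<and>
    (\<forall>v\<in>e. card {f \<in> edges. g f \<and> v \<in> f \<and> U f < U e} < \<kappa> v))"
  define s where "s = wfrec (earlier_adjacent U) F"
  have adm: "adm_wf (earlier_adjacent U) F"
    unfolding adm_wf_def
  proof (intro allI impI)
    fix g h :: "edge \<Rightarrow> bool" and e
    assume eq: "\<forall>z. (z, e) \<in> earlier_adjacent U \<longrightarrow> g z = h z"
    have "{f \<in> edges. g f \<and> v \<in> f \<and> U f < U e} = {f \<in> edges. h f \<and> v \<in> f \<and> U f < U e}"
      if "v \<in> e" "e \<in> edges" for v
      using eq that by (auto simp: earlier_adjacent_def)
    then show "F g e = F h e"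
      unfolding F_def by auto
  qed
  have s: "s e = F s e" for e
    using wfrec_fixpoint[OF wf adm] unfolding s_def by metis
  have sub: "f \<in> edges" if "s f" for f
    using s[of f] that by (simp add: F_def)
  have "cdp_dynamics \<kappa> U {e. s e}"
    unfolding cdp_dynamics_def
  proof (intro conjI ballI)
    show "{e. s e} \<subseteq> edges"
      using sub by auto
    fix e assume e: "e \<in> edges"
    have "{f \<in> edges. s f \<and> v \<in> f \<and> U f < U e} = {f \<in> {e. s e}. v \<in> f \<and> U f < U e}" for v
      using sub by auto
    then show "e \<in> {e. s e} \<longleftrightarrow> (\<forall>v\<in>e. card {f \<in> {e. s e}. v \<in> f \<and> U f < U e} < \<kappa> v)"
      using s[of e] e by (simp add: F_def)
  qed
  then show "\<exists>S. cdp_dynamics \<kappa> U S"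
    by blast
next
  fix S T
  assume S: "cdp_dynamics \<kappa> U S" and T: "cdp_dynamics \<kappa> U T"
  have "e \<in> edges \<longrightarrow> (e \<in> S \<longleftrightarrow> e \<in> T)" for e
    using wf
  proof (induction e rule: wf_induct_rule)
    case (less e)
    show ?case
    proof
      assume e: "e \<in> edges"
      have "{f \<in> S. v \<in> f \<and> U f < U e} = {f \<in> T. v \<in> f \<and> U f < U e}" if "v \<in> e" for v
      proof -
        have "f \<in> S \<longleftrightarrow> f \<in> T" if "v \<in> f" "U f < U e" for f
        proof (cases "f \<in> edges")
          case True
          then have "(f, e) \<in> earlier_adjacent U"
            using that \<open>v \<in> e\<close> e by (auto simp: earlier_adjacent_def)
          with less True show ?thesis by blast
        next
          case False
          then show ?thesis
            using S T by (auto simp: cdp_dynamics_def)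
        qed
        then show ?thesis by blast
      qed
      then show "e \<in> S \<longleftrightarrow> e \<in> T"
        using S T e unfolding cdp_dynamics_def by auto
    qed
  qed
  then show "S = T"
    using S T unfolding cdp_dynamics_def by blast
qed

definition cdp_config ::
    "real \<Rightarrow> (vertex \<Rightarrow> nat) \<times> (edge \<Rightarrow> real) \<Rightarrow> (edge \<Rightarrow> bool)" where
  "cdp_config t = (\<lambda>(\<kappa>, U). \<lambda>e\<in>edges. U e \<le> t \<and> e \<in> successful \<kappa> U)"

definition environment :: "nat pmf \<Rightarrow> ((vertex \<Rightarrow> nat) \<times> (edge \<Rightarrow> real)) measure" where
  "environment \<rho> =
     PiM UNIV (\<lambda>_. measure_pmf \<rho>) \<Otimes>\<^sub>M PiM edges (\<lambda>_. uniform_measure lborel {0<..1})"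

definition cdpre :: "nat pmf \<Rightarrow> real \<Rightarrow> (edge \<Rightarrow> bool) measure" where
  "cdpre \<rho> t = distr (environment \<rho>) (PiM edges (\<lambda>_. count_space UNIV)) (cdp_config t)"

definition open_connected :: "(edge \<Rightarrow> bool) \<Rightarrow> vertex \<Rightarrow> vertex \<Rightarrow> bool" where
  "open_connected \<omega> x y \<longleftrightarrow> (x, y) \<in> {(u, v). {u, v} \<in> edges \<and> \<omega> {u, v}}\<^sup>*"

definition cluster :: "(edge \<Rightarrow> bool) \<Rightarrow> vertex set" where
  "cluster \<omega> = {x. open_connected \<omega> (0, 0) x}"

text \<open>The counting measure gives the cardinality, with value \<open>\<infinity>\<close> for infinite clusters.\<close>

definition mean_cluster_size :: "nat pmf \<Rightarrow> real \<Rightarrow> ennreal" where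
  "mean_cluster_size \<rho> t = (\<integral>\<^sup>+ \<omega>. emeasure (count_space UNIV) (cluster \<omega>) \<partial>cdpre \<rho> t)"

definition critical_time :: "nat pmf \<Rightarrow> real" where
  "critical_time \<rho> = Sup {s \<in> {0..1}. mean_cluster_size \<rho> s < \<infinity>}"

definition box :: "nat \<Rightarrow> vertex set" where
  "box n = {- int n..int n} \<times> {- int n..int n}"

definition box_boundary :: "nat \<Rightarrow> vertex set" where
  "box_boundary n = {x \<in> box n. \<exists>y. {x, y} \<in> edges \<and> y \<notin> box n}"

definition connection_prob :: "nat pmf \<Rightarrow> real \<Rightarrow> nat \<Rightarrow> real" where
  "connection_prob \<rho> t n =
     measure (cdpre \<rho> t)
       {\<omega> \<in> space (cdpre \<rho> t). \<exists>x\<in>box_boundary n. open_connected \<omega> (0, 0) x}"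

end

theory Submission
  imports Defs "HOL-Combinatorics.Multiset_Permutations"
begin

text \<open>
  The state of an edge is determined by the edges reachable from it along chains of adjacent edges
  with decreasing clocks, and a chain of \<open>k + 1\<close> edges exists with probability at most
  \<open>8 ^ k / (k + 1)!\<close>. Call a vertex good at scale \<open>m\<close> if it is connected to distance \<open>m\<close>, or if a
  chain of length \<open>m\<close> starts near it. Goodness has range of order \<open>m\<close>, and on an open path from the
  origin to distance at least \<open>2 * m\<close> every vertex is good. Since good vertices at distance
  \<open>R = 4 * m + 1\<close> are independent, the probability that a path of good vertices reaches distance
  \<open>R + n\<close> is at most \<open>q\<close> times the corresponding probability for \<open>n\<close>, where \<open>q\<close> is the size of the
  sphere of radius \<open>R\<close> times the probability of being good; up to a negligible error this is a
  multiple of \<open>m * \<theta>\<^sub>m\<close>. Below the critical time \<open>\<theta>\<close> is summable, as the cluster contains at least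
  one vertex at each distance reached, and decreasing, so \<open>m * \<theta>\<^sub>m\<close> tends to \<open>0\<close> and \<open>q \<le> 1 / 2\<close>
  for some \<open>m\<close>.
\<close>

text \<open>Raising a constraint or advancing a clock may block edges elsewhere, so the
  configuration is not monotone in the environment and an open path cannot be cut into pieces by a
  BK-type inequality; moreover each edge depends on an unbounded set of clocks. Goodness has a
  deterministic range instead, so exact independence at a distance takes the place of correlation
  inequalities. The value \<open>4 * m + 1\<close> is the least distance at which two balls of
  radius \<open>2 * m\<close>, the range of goodness, are disjoint. In the plane spheres grow
  linearly, and that \<open>m * \<theta>\<^sub>m\<close> tends to 0 is just what summability of a
  decreasing sequence provides. The contraction only controls multiples of \<open>R\<close>, whereas
  the claim has no prefactor; distances below \<open>2 * R\<close> are therefore treated separately,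
  through \<open>\<theta>\<^sub>1 < 1\<close>.\<close>

definition sup_dist :: "vertex \<Rightarrow> vertex \<Rightarrow> int" where
  "sup_dist x y = max \<bar>fst x - fst y\<bar> \<bar>snd x - snd y\<bar>"

lemma sup_dist_le_iff: "sup_dist x y \<le> r \<longleftrightarrow> \<bar>fst x - fst y\<bar> \<le> r \<and> \<bar>snd x - snd y\<bar> \<le> r"
  by (simp add: sup_dist_def)

lemma sup_dist_self [simp]: "sup_dist x x = 0"
  by (simp add: sup_dist_def)

lemma sup_dist_commute: "sup_dist x y = sup_dist y x"
  by (simp add: sup_dist_def abs_minus_commute)

lemma sup_dist_triangle: "sup_dist x z \<le> sup_dist x y + sup_dist y z"
proof -
  have "\<bar>fst a - fst b\<bar> \<le> sup_dist a b" "\<bar>snd a - snd b\<bar> \<le> sup_dist a b" for a b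
    by (simp_all add: sup_dist_def)
  from this[of x y] this[of y z] show ?thesis
    unfolding sup_dist_le_iff[of x z] by linarith
qed

lemma sup_dist_add_right [simp]: "sup_dist (x + a) (y + a) = sup_dist x y"
  by (simp add: sup_dist_def)

section \<open>Edges of the square lattice: incidence and counting\<close>

lemma mem_edges_iff: "{u, v} \<in> edges \<longleftrightarrow> \<bar>fst u - fst v\<bar> + \<bar>snd u - snd v\<bar> = 1"
proof
  assume "{u, v} \<in> edges"
  then obtain u' v' where "{u, v} = {u', v'}" "\<bar>fst u' - fst v'\<bar> + \<bar>snd u' - snd v'\<bar> = 1"
    unfolding edges_def by blast
  then show "\<bar>fst u - fst v\<bar> + \<bar>snd u - snd v\<bar> = 1"
    unfolding doubleton_eq_iff by (metis abs_minus_commute)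
qed (auto simp only: edges_def)

lemma sup_dist_edge: "{u, v} \<in> edges \<Longrightarrow> sup_dist u v \<le> 1"
  unfolding mem_edges_iff sup_dist_le_iff by linarith

lemma edge_cases:
  assumes "e \<in> edges"
  obtains u v where "e = {u, v}" "{u, v} \<in> edges" "u \<noteq> v"
proof -
  from assms obtain u v where uv: "e = {u, v}" "\<bar>fst u - fst v\<bar> + \<bar>snd u - snd v\<bar> = 1"
    by (auto simp: edges_def)
  then have "u \<noteq> v"
    by auto
  with uv show thesis
    using that assms by blast
qed

lemma sup_dist_in_edge:
  assumes "e \<in> edges" "u \<in> e" "v \<in> e"
  shows "sup_dist u v \<le> 1"
proof -
  obtain a b where ab: "e = {a, b}" "{a, b} \<in> edges"
    using assms(1) by (rule edge_cases)
  then have "sup_dist a b \<le> 1" "sup_dist b a \<le> 1"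
    using sup_dist_edge sup_dist_commute by metis+
  moreover have "(u = a \<or> u = b) \<and> (v = a \<or> v = b)"
    using assms ab by simp
  ultimately show ?thesis
    by (elim conjE disjE) simp_all
qed

lemma finite_edge:
  assumes "e \<in> edges" shows "finite e"
  using assms by (rule edge_cases) simp

lemma card_edge:
  assumes "e \<in> edges" shows "card e = 2"
  using assms by (rule edge_cases) simp

lemma countable_edges [simp]: "countable edges"
proof (rule countable_subset)
  show "edges \<subseteq> (\<lambda>(u, v). {u, v}) ` UNIV"
    by (auto simp: edges_def)
qed simp

definition incident :: "vertex \<Rightarrow> edge set" where
  "incident v = {f \<in> edges. v \<in> f}"

lemma incident_subset:
  "incident v \<subseteq> (\<lambda>d. {v, v + d}) ` {(1, 0), (-1, 0), (0, 1), (0, -1)}"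
proof
  fix f assume f: "f \<in> incident v"
  then obtain w where w: "f = {v, w}"
    by (auto simp: incident_def edges_def)
  with f have "\<bar>fst (w - v)\<bar> + \<bar>snd (w - v)\<bar> = 1"
    by (simp add: incident_def mem_edges_iff abs_minus_commute)
  then have "w - v \<in> {(1, 0), (-1, 0), (0, 1), (0, -1)}"
    by (cases "w - v") (simp, presburger)
  moreover have "f = {v, v + (w - v)}"
    using w by simp
  ultimately show "f \<in> (\<lambda>d. {v, v + d}) ` {(1, 0), (-1, 0), (0, 1), (0, -1)}"
    by blast
qed

lemma finite_incident [simp]: "finite (incident v)"
  by (rule finite_subset[OF incident_subset]) simp

lemma card_incident_le: "card (incident v) \<le> 4"
  using card_mono[OF _ incident_subset[of v]] card_image_le[of "{(1, 0), (-1, 0), (0, 1), (0, -1)} :: vertex set" "\<lambda>d. {v, v + d}"]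
  by auto

definition touching :: "edge \<Rightarrow> edge set" where
  "touching e = {f \<in> edges. f \<inter> e \<noteq> {}}"

lemma touching_eq: "touching e = (\<Union>v\<in>e. incident v)"
  by (auto simp: touching_def incident_def)

lemma finite_touching: "e \<in> edges \<Longrightarrow> finite (touching e)"
  by (auto simp: touching_eq dest: finite_edge)

text \<open>Both endpoints have degree four. The edge \<open>e\<close> touches itself and is counted
  at both ends; the crude 8 becomes the base of the walk count \<open>8 ^ k\<close>.\<close>

lemma card_touching_le:
  assumes "e \<in> edges" shows "card (touching e) \<le> 8"
proof -
  have "card (touching e) \<le> (\<Sum>v\<in>e. card (incident v))"
    unfolding touching_eq by (rule card_UN_le[OF finite_edge[OF assms]])
  also have "\<dots> \<le> (\<Sum>v\<in>e. 4)"
    by (rule sum_mono) (rule card_incident_le)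
  finally show ?thesis
    by (simp add: card_edge[OF assms])
qed

lemma finite_sup_ball: "finite {w. sup_dist x w \<le> r}"
proof (rule finite_subset)
  show "{w. sup_dist x w \<le> r} \<subseteq> {fst x - r..fst x + r} \<times> {snd x - r..snd x + r}"
    by (auto simp: sup_dist_def)
qed simp

lemma finite_edges_in_ball: "finite {e \<in> edges. e \<subseteq> {w. sup_dist x w \<le> r}}"
  by (rule finite_subset[of _ "Pow {w. sup_dist x w \<le> r}"]) (auto simp: finite_sup_ball)

lemma card_Union_le_sum_list: "card (\<Union>(set As)) \<le> sum_list (map card As)"
  by (induction As) (auto intro: order_trans[OF card_Un_le])

text \<open>The sphere is covered by the four sides of a square. Corners are counted twice, but only
  linear growth in \<open>r\<close> matters.\<close>

lemma card_sphere_le: "card {w. sup_dist x w = int r} \<le> 4 * (2 * r + 1)"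
proof -
  define R where "R = int r"
  let ?S = "[{fst x - R} \<times> {snd x - R..snd x + R}, {fst x + R} \<times> {snd x - R..snd x + R},
    {fst x - R..fst x + R} \<times> {snd x - R}, {fst x - R..fst x + R} \<times> {snd x + R}]"
  have "card {w. sup_dist x w = R} \<le> card (\<Union>(set ?S))"
  proof (rule card_mono)
    show "{w. sup_dist x w = R} \<subseteq> \<Union>(set ?S)"
    proof
      fix w assume "w \<in> {w. sup_dist x w = R}"
      then have "\<bar>fst x - fst w\<bar> \<le> R" "\<bar>snd x - snd w\<bar> \<le> R"
        "\<bar>fst x - fst w\<bar> = R \<or> \<bar>snd x - snd w\<bar> = R"
        by (auto simp: sup_dist_def max_def split: if_splits)
      then show "w \<in> \<Union>(set ?S)"
        by (cases w) (auto simp: abs_if split: if_splits)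
    qed
  qed simp
  also have "\<dots> \<le> sum_list (map card ?S)"
    by (rule card_Union_le_sum_list)
  also have "\<dots> = 4 * (2 * r + 1)"
    by (simp add: card_cartesian_product R_def nat_add_distrib)
  finally show ?thesis
    by (simp add: R_def)
qed

text \<open>Every such edge is incident to one of the \<open>(2 * r + 1)\<^sup>2\<close> vertices of
  the ball, each of degree at most four.\<close>

lemma card_edges_in_ball_le: "card {e \<in> edges. e \<subseteq> {w. sup_dist x w \<le> int r}} \<le> 4 * (2 * r + 1)\<^sup>2"
proof -
  let ?B = "{fst x - int r..fst x + int r} \<times> {snd x - int r..snd x + int r}"
  have "card {e \<in> edges. e \<subseteq> {w. sup_dist x w \<le> int r}} \<le> card (\<Union>v\<in>?B. incident v)"
  proof (rule card_mono)
    show "{e \<in> edges. e \<subseteq> {w. sup_dist x w \<le> int r}} \<subseteq> (\<Union>v\<in>?B. incident v)"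
    proof
      fix e assume e: "e \<in> {e \<in> edges. e \<subseteq> {w. sup_dist x w \<le> int r}}"
      then obtain u v where "e = {u, v}"
        by (blast elim: edge_cases)
      moreover from this have "u \<in> ?B"
        using e by (cases u) (auto simp: sup_dist_le_iff)
      ultimately show "e \<in> (\<Union>v\<in>?B. incident v)"
        using e by (auto simp: incident_def)
    qed
  qed simp
  also have "\<dots> \<le> (\<Sum>v\<in>?B. card (incident v))"
    by (rule card_UN_le) simp
  also have "\<dots> \<le> (\<Sum>v\<in>?B. 4)"
    by (rule sum_mono) (rule card_incident_le)
  also have "\<dots> = 4 * (2 * r + 1)\<^sup>2"
    by (simp add: card_cartesian_product power2_eq_square nat_add_distrib nat_mult_distrib algebra_simps)
  finally show ?thesis .
qed

subsection \<open>Finite approximations of the dynamics\<close>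

text \<open>Picard iteration of the opening rule from the empty configuration. Since edges block one
  another, the iterates are not monotone in \<open>k\<close>; for well-founded clocks
  \<open>approx k\<close> is exact at the edges where \<open>chain k\<close> fails.\<close>

primrec approx :: "nat \<Rightarrow> (vertex \<Rightarrow> nat) \<Rightarrow> (edge \<Rightarrow> real) \<Rightarrow> edge set" where
  "approx 0 \<kappa> U = {}"
| "approx (Suc k) \<kappa> U =
     {e \<in> edges. \<forall>v\<in>e. card {f \<in> approx k \<kappa> U. v \<in> f \<and> U f < U e} < \<kappa> v}"

text \<open>In other words, the rank of \<open>e\<close> under \<open>earlier_adjacent U\<close> is
  at least \<open>k\<close>; the chain has \<open>k + 1\<close> edges, counting
  \<open>e\<close>.\<close>

primrec chain :: "nat \<Rightarrow> (edge \<Rightarrow> real) \<Rightarrow> edge \<Rightarrow> bool" where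
  "chain 0 U e \<longleftrightarrow> e \<in> edges"
| "chain (Suc k) U e \<longleftrightarrow> (\<exists>f. (f, e) \<in> earlier_adjacent U \<and> chain k U f)"

lemma approx_subset_edges: "approx k \<kappa> U \<subseteq> edges"
  by (cases k) auto

lemma chain_edge: "chain k U e \<Longrightarrow> e \<in> edges"
  by (cases k) (auto simp: earlier_adjacent_def)

lemma chain_Suc_imp: "chain (Suc k) U e \<Longrightarrow> chain k U e"
proof (induction k arbitrary: e)
  case (Suc k)
  then show ?case by (metis chain.simps(2))
qed (auto simp: earlier_adjacent_def)

lemma chain_mono: "chain k U e \<Longrightarrow> l \<le> k \<Longrightarrow> chain l U e"
proof (induction k)
  case (Suc k)
  then show ?case
    using chain_Suc_imp[of k U e] le_Suc_eq by blast
qed simp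

text \<open>An edge has finitely many predecessors, so bounds on the chains from them have a
  maximum, as in Koenig's lemma; conversely, the least \<open>k\<close> at which
  \<open>chain k\<close> fails is a rank function. Well-foundedness thus becomes a countable
  condition, which is measurable.\<close>

lemma wf_earlier_adjacent_iff: "wf (earlier_adjacent U) \<longleftrightarrow> (\<forall>e\<in>edges. \<exists>k. \<not> chain k U e)"
proof
  assume wf: "wf (earlier_adjacent U)"
  show "\<forall>e\<in>edges. \<exists>k. \<not> chain k U e"
  proof
    fix e assume "e \<in> edges"
    from wf this show "\<exists>k. \<not> chain k U e"
    proof (induction e rule: wf_induct_rule)
      case (less e)
      let ?P = "{f. (f, e) \<in> earlier_adjacent U}"
      have "finite ?P"
      proof (rule finite_subset)
        show "?P \<subseteq> touching e"
          unfolding earlier_adjacent_def touching_def by blast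
      qed (rule finite_touching[OF less.prems])
      moreover have "\<forall>f. \<exists>k. f \<in> ?P \<longrightarrow> \<not> chain k U f"
      proof
        fix f
        show "\<exists>k. f \<in> ?P \<longrightarrow> \<not> chain k U f"
          using less.IH[of f] unfolding earlier_adjacent_def by blast
      qed
      then obtain K where K: "\<And>f. f \<in> ?P \<Longrightarrow> \<not> chain (K f) U f"
        unfolding choice_iff by blast
      ultimately have "K f \<le> Max (insert 0 (K ` ?P))" if "f \<in> ?P" for f
        using that by (intro Max_ge) simp_all
      then have "\<not> chain (Max (insert 0 (K ` ?P))) U f" if "f \<in> ?P" for f
        using that K chain_mono by blast
      then have "\<not> chain (Suc (Max (insert 0 (K ` ?P)))) U e"
        unfolding chain.simps by blast
      then show ?case ..
    qed
  qed
next
  assume ex: "\<forall>e\<in>edges. \<exists>k. \<not> chain k U e"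
  define K where "K e = (LEAST k. \<not> chain k U e)" for e
  have "K f < K e" if fe: "(f, e) \<in> earlier_adjacent U" for f e
  proof -
    have e: "e \<in> edges"
      using fe unfolding earlier_adjacent_def by blast
    have not_chain: "\<not> chain (K e) U e"
      unfolding K_def by (rule LeastI_ex) (rule bspec[OF ex e])
    with e obtain k where k: "K e = Suc k"
      by (cases "K e") simp_all
    have "\<not> chain k U f"
      using not_chain fe unfolding k chain.simps by blast
    then have "K f \<le> k"
      unfolding K_def by (rule Least_le)
    with k show ?thesis by simp
  qed
  then have "earlier_adjacent U \<subseteq> inv_image less_than K"
    by auto
  then show "wf (earlier_adjacent U)"
    by (rule wf_subset[OF wf_inv_image[OF wf_less_than]])
qed

lemma cdp_dynamics_successful:
  "wf (earlier_adjacent U) \<Longrightarrow> cdp_dynamics \<kappa> U (successful \<kappa> U)"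
  using theI'[OF cdp_dynamics_ex1] by (simp add: successful_def)

text \<open>Chains from a predecessor of \<open>e\<close> are shorter by one, so the iteration has
  settled there one step earlier.\<close>

lemma approx_eq_successful:
  assumes wf: "wf (earlier_adjacent U)" and "\<not> chain k U e" "e \<in> edges"
  shows "e \<in> approx k \<kappa> U \<longleftrightarrow> e \<in> successful \<kappa> U"
  using assms(2,3)
proof (induction k arbitrary: e)
  case (Suc k)
  note dyn = cdp_dynamics_successful[OF wf, of \<kappa>]
  have "{f \<in> approx k \<kappa> U. v \<in> f \<and> U f < U e} = {f \<in> successful \<kappa> U. v \<in> f \<and> U f < U e}"
    if "v \<in> e" for v
  proof -
    have "f \<in> approx k \<kappa> U \<longleftrightarrow> f \<in> successful \<kappa> U" if "v \<in> f" "U f < U e" "f \<in> edges" for f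
    proof (rule Suc.IH)
      have "(f, e) \<in> earlier_adjacent U"
        using that \<open>v \<in> e\<close> Suc.prems by (auto simp: earlier_adjacent_def)
      then show "\<not> chain k U f"
        using Suc.prems by auto
    qed fact
    then show ?thesis
      using approx_subset_edges[of k \<kappa> U] dyn by (auto simp: cdp_dynamics_def)
  qed
  then show ?case
    using dyn Suc.prems unfolding cdp_dynamics_def by auto
qed simp

text \<open>A description by countably many finite-stage events, from which measurability follows.
  The middle conjunct is well-foundedness and makes both sides false on the exceptional
  clocks.\<close>

lemma successful_iff:
  "e \<in> successful \<kappa> U \<longleftrightarrow> e \<in> edges \<and> (\<forall>e\<in>edges. \<exists>k. \<not> chain k U e) \<and>
     (\<exists>k. \<not> chain k U e \<and> e \<in> approx k \<kappa> U)"
proof (cases "wf (earlier_adjacent U)")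
  case True
  then have all: "\<forall>e\<in>edges. \<exists>k. \<not> chain k U e"
    by (simp only: wf_earlier_adjacent_iff)
  have "e \<in> edges" if "e \<in> successful \<kappa> U"
    using that cdp_dynamics_successful[OF True, of \<kappa>] unfolding cdp_dynamics_def by blast
  moreover have "e \<in> successful \<kappa> U \<longleftrightarrow> (\<exists>k. \<not> chain k U e \<and> e \<in> approx k \<kappa> U)" if "e \<in> edges"
    using approx_eq_successful[OF True _ that] bspec[OF all that] by metis
  ultimately show ?thesis
    using all by metis
next
  case False
  then show ?thesis
    by (simp add: successful_def flip: wf_earlier_adjacent_iff)
qed

subsection \<open>Locality\<close>

text \<open>Clocks are read only on edges with both endpoints in \<open>W\<close>, so disjoint
  vertex sets give disjoint sets of coordinates.\<close>

definition local_in :: "vertex set \<Rightarrow> ((vertex \<Rightarrow> nat) \<times> (edge \<Rightarrow> real) \<Rightarrow> 'b) \<Rightarrow> bool" where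
  "local_in W Q \<longleftrightarrow> (\<forall>\<kappa> \<kappa>' U U'. (\<forall>v\<in>W. \<kappa> v = \<kappa>' v) \<longrightarrow> (\<forall>e\<in>edges. e \<subseteq> W \<longrightarrow> U e = U' e) \<longrightarrow>
     Q (\<kappa>, U) = Q (\<kappa>', U'))"

lemma local_inI:
  assumes "\<And>\<kappa> \<kappa>' U U'. (\<And>v. v \<in> W \<Longrightarrow> \<kappa> v = \<kappa>' v) \<Longrightarrow>
    (\<And>e. e \<in> edges \<Longrightarrow> e \<subseteq> W \<Longrightarrow> U e = U' e) \<Longrightarrow> Q (\<kappa>, U) = Q (\<kappa>', U')"
  shows "local_in W Q"
  unfolding local_in_def by (intro allI impI assms) simp_all

lemma local_inD:
  assumes "local_in W Q" "\<And>v. v \<in> W \<Longrightarrow> \<kappa> v = \<kappa>' v" "\<And>e. e \<in> edges \<Longrightarrow> e \<subseteq> W \<Longrightarrow> U e = U' e"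
  shows "Q (\<kappa>, U) = Q (\<kappa>', U')"
  using assms(1)[unfolded local_in_def, rule_format, of \<kappa> \<kappa>' U U'] assms(2,3) by simp

lemma local_in_mono:
  assumes "local_in W Q" "W \<subseteq> W'"
  shows "local_in W' Q"
proof (rule local_inI)
  fix \<kappa> \<kappa>' :: "vertex \<Rightarrow> nat" and U U' :: "edge \<Rightarrow> real"
  assume "\<And>v. v \<in> W' \<Longrightarrow> \<kappa> v = \<kappa>' v" "\<And>e. e \<in> edges \<Longrightarrow> e \<subseteq> W' \<Longrightarrow> U e = U' e"
  with assms(2) show "Q (\<kappa>, U) = Q (\<kappa>', U')"
    by (intro local_inD[OF assms(1)]) auto
qed

lemma local_in_const: "local_in W (\<lambda>s. c)"
  by (rule local_inI) simp

lemma local_in_comp2: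
  assumes "local_in W P" "local_in W Q"
  shows "local_in W (\<lambda>s. h (P s) (Q s))"
proof (rule local_inI)
  fix \<kappa> \<kappa>' :: "vertex \<Rightarrow> nat" and U U' :: "edge \<Rightarrow> real"
  assume *: "\<And>v. v \<in> W \<Longrightarrow> \<kappa> v = \<kappa>' v" "\<And>e. e \<in> edges \<Longrightarrow> e \<subseteq> W \<Longrightarrow> U e = U' e"
  show "h (P (\<kappa>, U)) (Q (\<kappa>, U)) = h (P (\<kappa>', U')) (Q (\<kappa>', U'))"
    by (simp only: local_inD[OF assms(1) *] local_inD[OF assms(2) *])
qed

text \<open>As \<open>h\<close> is an arbitrary functional of the whole family, quantifiers and
  reflexive transitive closures are covered at once.\<close>

lemma local_in_family:
  assumes "\<And>x. local_in W (P x)"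
  shows "local_in W (\<lambda>s. h (\<lambda>x. P x s))"
proof (rule local_inI)
  fix \<kappa> \<kappa>' :: "vertex \<Rightarrow> nat" and U U' :: "edge \<Rightarrow> real"
  assume *: "\<And>v. v \<in> W \<Longrightarrow> \<kappa> v = \<kappa>' v" "\<And>e. e \<in> edges \<Longrightarrow> e \<subseteq> W \<Longrightarrow> U e = U' e"
  show "h (\<lambda>x. P x (\<kappa>, U)) = h (\<lambda>x. P x (\<kappa>', U'))"
    by (simp only: local_inD[OF assms *])
qed

lemmas local_in_conj = local_in_comp2[where h = "(\<and>)"]
  and local_in_disj = local_in_comp2[where h = "(\<or>)"]
  and local_in_Ex = local_in_family[where h = Ex]

lemma local_in_rtrancl:
  assumes "\<And>x y. local_in W (P x y)"
  shows "local_in W (\<lambda>s. (u, v) \<in> {(x, y). P x y s}\<^sup>*)"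
  using local_in_family[of W "\<lambda>z. P (fst z) (snd z)" "\<lambda>p. (u, v) \<in> {z. p z}\<^sup>*"] assms
  by (simp add: case_prod_unfold)

definition edge_nbhd :: "nat \<Rightarrow> edge \<Rightarrow> vertex set" where
  "edge_nbhd k e = {w. \<exists>v\<in>e. sup_dist v w \<le> int k}"

lemma subset_edge_nbhd: "e \<subseteq> edge_nbhd k e"
  unfolding edge_nbhd_def by (auto intro!: bexI)

text \<open>The endpoints of an edge are at distance at most one, so each further iteration or chain
  step enlarges the range by one.\<close>

lemma edge_nbhd_touching:
  assumes "f \<in> edges" "v \<in> f" "v \<in> e"
  shows "edge_nbhd k f \<subseteq> edge_nbhd (Suc k) e"
proof
  fix w assume "w \<in> edge_nbhd k f"
  then obtain u where "u \<in> f" "sup_dist u w \<le> int k"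
    by (auto simp: edge_nbhd_def)
  moreover have "sup_dist v u \<le> 1"
    using sup_dist_in_edge assms \<open>u \<in> f\<close> by blast
  ultimately have "sup_dist v w \<le> int (Suc k)"
    using sup_dist_triangle[of v w u] by simp
  with assms show "w \<in> edge_nbhd (Suc k) e"
    by (auto simp: edge_nbhd_def)
qed

lemma local_in_approx: "local_in (edge_nbhd k e) (\<lambda>s. e \<in> approx k (fst s) (snd s))"
proof (induction k arbitrary: e)
  case (Suc k)
  show ?case
  proof (rule local_inI, unfold fst_conv snd_conv)
    fix \<kappa> \<kappa>' :: "vertex \<Rightarrow> nat" and U U' :: "edge \<Rightarrow> real"
    assume \<kappa>: "\<And>v. v \<in> edge_nbhd (Suc k) e \<Longrightarrow> \<kappa> v = \<kappa>' v"
      and U: "\<And>f. f \<in> edges \<Longrightarrow> f \<subseteq> edge_nbhd (Suc k) e \<Longrightarrow> U f = U' f"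
    have "{f \<in> approx k \<kappa> U. v \<in> f \<and> U f < U e} = {f \<in> approx k \<kappa>' U'. v \<in> f \<and> U' f < U' e}"
      if "v \<in> e" "e \<in> edges" for v
    proof -
      have "f \<in> approx k \<kappa> U \<longleftrightarrow> f \<in> approx k \<kappa>' U'" "U f = U' f" if "v \<in> f" "f \<in> edges" for f
      proof -
        have sub: "edge_nbhd k f \<subseteq> edge_nbhd (Suc k) e"
          using edge_nbhd_touching that \<open>v \<in> e\<close> by blast
        show "f \<in> approx k \<kappa> U \<longleftrightarrow> f \<in> approx k \<kappa>' U'"
          by (rule local_inD[OF Suc.IH[of f], unfolded fst_conv snd_conv]) (use \<kappa> U sub in blast)+
        show "U f = U' f"
          using U that sub subset_edge_nbhd[of f k] by blast
      qed
      moreover have "U e = U' e"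
        using U that subset_edge_nbhd[of e "Suc k"] by blast
      ultimately show ?thesis
        using approx_subset_edges[of k] by (intro Collect_cong) (metis subsetD)
    qed
    moreover have "\<kappa> v = \<kappa>' v" if "v \<in> e" for v
      using \<kappa> that subset_edge_nbhd[of e "Suc k"] by blast
    ultimately show "e \<in> approx (Suc k) \<kappa> U \<longleftrightarrow> e \<in> approx (Suc k) \<kappa>' U'"
      by auto
  qed
qed (simp add: local_in_const)

lemma local_in_chain: "local_in (edge_nbhd k e) (\<lambda>s. chain k (snd s) e)"
proof (induction k arbitrary: e)
  case (Suc k)
  show ?case
  proof (rule local_inI, unfold fst_conv snd_conv)
    fix \<kappa> \<kappa>' :: "vertex \<Rightarrow> nat" and U U' :: "edge \<Rightarrow> real"
    assume \<kappa>: "\<And>v. v \<in> edge_nbhd (Suc k) e \<Longrightarrow> \<kappa> v = \<kappa>' v"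
      and U: "\<And>f. f \<in> edges \<Longrightarrow> f \<subseteq> edge_nbhd (Suc k) e \<Longrightarrow> U f = U' f"
    have "(f, e) \<in> earlier_adjacent U \<and> chain k U f \<longleftrightarrow> (f, e) \<in> earlier_adjacent U' \<and> chain k U' f" for f
    proof (cases "f \<in> edges \<and> e \<in> edges \<and> f \<inter> e \<noteq> {}")
      case True
      then obtain v where v: "v \<in> f" "v \<in> e"
        by blast
      have sub: "edge_nbhd k f \<subseteq> edge_nbhd (Suc k) e"
        using edge_nbhd_touching True v by blast
      have "chain k U f \<longleftrightarrow> chain k U' f"
        by (rule local_inD[OF Suc.IH[of f], of \<kappa> \<kappa>', unfolded fst_conv snd_conv])
          (use \<kappa> U sub in blast)+
      moreover have "U f = U' f"
        using U True sub subset_edge_nbhd[of f k] by blast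
      moreover have "U e = U' e"
        using U True subset_edge_nbhd[of e "Suc k"] by blast
      ultimately show ?thesis
        by (simp add: earlier_adjacent_def)
    next
      case False
      then show ?thesis unfolding earlier_adjacent_def by blast
    qed
    then show "chain (Suc k) U e \<longleftrightarrow> chain (Suc k) U' e"
      by simp
  qed
qed (simp add: local_in_const)

declare split_paired_Ex [simp del] split_paired_All [simp del]

abbreviation sup_ball :: "vertex \<Rightarrow> nat \<Rightarrow> vertex set" where
  "sup_ball x r \<equiv> {w. sup_dist x w \<le> int r}"

subsection \<open>Paths\<close>

text \<open>A step changes the distance from \<open>x\<close> by at most one, so the path cannot
  jump over the sphere; up to its first visit there it stays in the ball.\<close>

lemma exit_ball:
  assumes path: "(x, y) \<in> r\<^sup>*" and r: "\<And>u v. (u, v) \<in> r \<Longrightarrow> {u, v} \<in> edges"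
    and far: "int m \<le> sup_dist x y"
  obtains z where "sup_dist x z = int m" "(x, z) \<in> (r \<inter> sup_ball x m \<times> sup_ball x m)\<^sup>*"
proof -
  let ?r = "r \<inter> sup_ball x m \<times> sup_ball x m"
  from path have "(\<exists>z. sup_dist x z = int m \<and> (x, z) \<in> ?r\<^sup>*) \<or> sup_dist x y < int m \<and> (x, y) \<in> ?r\<^sup>*"
  proof induction
    case base
    show ?case
      by (cases m) (auto intro!: exI[of _ x])
  next
    case (step y z)
    show ?case
    proof (cases "sup_dist x y < int m \<and> (x, y) \<in> ?r\<^sup>*")
      case True
      have "sup_dist x z \<le> sup_dist x y + 1"
        using sup_dist_triangle[of x z y] sup_dist_edge[OF r[OF step.hyps(2)]] by simp
      then have z: "sup_dist x z \<le> int m"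
        using True by simp
      then have "(x, z) \<in> ?r\<^sup>*"
        using True step.hyps(2) by (auto intro: rtrancl_into_rtrancl)
      with z show ?thesis
        by (cases "sup_dist x z = int m") auto
    qed (use step.IH in blast)
  qed
  with far that show thesis
    by auto
qed

text \<open>Counterpart of \<open>exit_ball\<close> for the end of the path: the last entry into the
  complement of the open ball happens on the sphere, again because steps have length at most
  one.\<close>

lemma last_entry:
  assumes path: "(x, y) \<in> r\<^sup>*" and r: "\<And>u v. (u, v) \<in> r \<Longrightarrow> {u, v} \<in> edges"
    and far: "int m \<le> sup_dist x y"
  obtains z where "sup_dist x z = int m"
    "(z, y) \<in> (r \<inter> {w. int m \<le> sup_dist x w} \<times> {w. int m \<le> sup_dist x w})\<^sup>*"
proof -
  let ?r = "r \<inter> {w. int m \<le> sup_dist x w} \<times> {w. int m \<le> sup_dist x w}"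
  from path far have "\<exists>z. sup_dist x z = int m \<and> (z, y) \<in> ?r\<^sup>*"
  proof induction
    case base
    then show ?case by (auto intro!: exI[of _ x])
  next
    case (step y z)
    show ?case
    proof (cases "int m \<le> sup_dist x y")
      case True
      then obtain w where "sup_dist x w = int m" "(w, y) \<in> ?r\<^sup>*"
        using step.IH by blast
      moreover have "(y, z) \<in> ?r"
        using True step by auto
      ultimately show ?thesis
        by (blast intro: rtrancl_into_rtrancl)
    next
      \<comment> \<open>The path has just left the open ball, so the tail starts afresh at
        \<open>z\<close>.\<close>
      case False
      have "sup_dist x z \<le> sup_dist x y + 1"
        using sup_dist_triangle[of x z y] sup_dist_edge[OF r[OF step.hyps(2)]] by simp
      with False step.prems have "sup_dist x z = int m"
        by simp
      then show ?thesis
        by blast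
    qed
  qed
  with that show thesis by blast
qed

lemma box_eq_ball: "box n = sup_ball (0, 0) n"
  unfolding box_def sup_dist_le_iff by (auto simp: abs_le_iff)

lemma box_boundary_eq_sphere: "box_boundary n = {x. sup_dist (0, 0) x = int n}"
proof (intro set_eqI iffI)
  fix x assume "x \<in> box_boundary n"
  then obtain y where x: "sup_dist (0, 0) x \<le> int n" and y: "{x, y} \<in> edges" "\<not> sup_dist (0, 0) y \<le> int n"
    unfolding box_boundary_def box_eq_ball by blast
  then have "sup_dist (0, 0) x = int n"
    using sup_dist_triangle[of "(0, 0)" y x] sup_dist_edge[OF y(1)] by simp
  then show "x \<in> {x. sup_dist (0, 0) x = int n}"
    by simp
next
  fix x :: vertex assume "x \<in> {x. sup_dist (0, 0) x = int n}"
  then have n: "max \<bar>fst x\<bar> \<bar>snd x\<bar> = int n"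
    by (simp add: sup_dist_def)
  \<comment> \<open>\<open>\<sigma>\<close> moves a coordinate one step away from zero; applied to a
    coordinate of modulus \<open>n\<close> it leaves the box. Sending 0 to 1 covers
    \<open>n = 0\<close>.\<close>
  define \<sigma> :: "int \<Rightarrow> int" where "\<sigma> a = (if 0 \<le> a then a + 1 else a - 1)" for a
  have \<sigma>: "\<bar>\<sigma> a\<bar> = \<bar>a\<bar> + 1" "\<bar>a - \<sigma> a\<bar> = 1" for a
    by (auto simp: \<sigma>_def)
  define y where "y = (if \<bar>fst x\<bar> = int n then (\<sigma> (fst x), snd x) else (fst x, \<sigma> (snd x)))"
  have "{x, y} \<in> edges"
    by (simp add: mem_edges_iff y_def \<sigma>)
  moreover have "\<not> sup_dist (0, 0) y \<le> int n"
    using n by (auto simp: sup_dist_le_iff y_def \<sigma> max_def split: if_splits)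
  moreover have "sup_dist (0, 0) x \<le> int n"
    using n by (simp add: sup_dist_def)
  ultimately show "x \<in> box_boundary n"
    unfolding box_boundary_def box_eq_ball by blast
qed

subsection \<open>A finite-range process dominating the open clusters\<close>

type_synonym sample = "(vertex \<Rightarrow> nat) \<times> (edge \<Rightarrow> real)"

definition approx_open :: "real \<Rightarrow> nat \<Rightarrow> sample \<Rightarrow> edge set" where
  "approx_open t m s = {e \<in> approx m (fst s) (snd s). snd s e \<le> t}"

text \<open>
  If no decreasing chain of length \<open>m\<close> starts near \<open>x\<close>, then \<open>m\<close> iterations determine the dynamics
  near \<open>x\<close>. Declaring \<open>x\<close> good also when such a chain exists makes goodness depend only on the
  ball of radius \<open>2 * m\<close> around \<open>x\<close>.
\<close>

definition good :: "real \<Rightarrow> nat \<Rightarrow> vertex \<Rightarrow> sample \<Rightarrow> bool" where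
  "good t m x s \<longleftrightarrow>
     (\<exists>y. sup_dist x y = int m \<and>
       (x, y) \<in> {(u, v). {u, v} \<in> approx_open t m s \<and> {u, v} \<subseteq> sup_ball x m}\<^sup>*) \<or>
     (\<exists>e. e \<subseteq> sup_ball x m \<and> chain m (snd s) e)"

definition reach :: "real \<Rightarrow> nat \<Rightarrow> vertex \<Rightarrow> sample \<Rightarrow> bool" where
  "reach t n x s \<longleftrightarrow> (\<exists>y. sup_dist x y = int n \<and> open_connected (cdp_config t s) x y)"

text \<open>The region \<open>\<Lambda>\<close> allows the tail of a path to be confined to vertices
  far from its start, as independence requires. The distance is only bounded below because splitting
  a path gives no more than that for the tail. For \<open>n = 0\<close> the event is
  certain.\<close>

definition escape :: "real \<Rightarrow> nat \<Rightarrow> vertex set \<Rightarrow> nat \<Rightarrow> vertex \<Rightarrow> sample \<Rightarrow> bool" where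
  "escape t m \<Lambda> n x s \<longleftrightarrow> (\<exists>y. int n \<le> sup_dist x y \<and>
     (x, y) \<in> {(u, v). {u, v} \<in> edges \<and> {u, v} \<subseteq> \<Lambda> \<and> good t m u s \<and> good t m v s}\<^sup>*)"

lemma edge_nbhd_subset_ball:
  assumes "e \<subseteq> sup_ball x m"
  shows "edge_nbhd m e \<subseteq> sup_ball x (2 * m)"
proof
  fix w assume "w \<in> edge_nbhd m e"
  then obtain v where "v \<in> e" "sup_dist v w \<le> int m"
    by (auto simp: edge_nbhd_def)
  then show "w \<in> sup_ball x (2 * m)"
    using assms sup_dist_triangle[of x w v] by fastforce
qed

text \<open>The path and the starting edges of chains lie within \<open>m\<close> of
  \<open>x\<close>, and \<open>m\<close> iterations or chain steps at an edge look at most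
  \<open>m\<close> further.\<close>

lemma local_in_good: "local_in (sup_ball x (2 * m)) (good t m x)"
proof -
  let ?W = "sup_ball x (2 * m)"
  have "local_in ?W (\<lambda>s. {u, v} \<in> approx_open t m s \<and> {u, v} \<subseteq> sup_ball x m)" for u v
  proof (cases "{u, v} \<in> edges \<and> {u, v} \<subseteq> sup_ball x m")
    case True
    then have "edge_nbhd m {u, v} \<subseteq> ?W"
      using edge_nbhd_subset_ball by blast
    then have "local_in ?W (\<lambda>s. {u, v} \<in> approx m (fst s) (snd s))"
      by (rule local_in_mono[OF local_in_approx])
    moreover have "local_in ?W (\<lambda>s. snd s {u, v} \<le> t)"
    proof (rule local_inI)
      fix \<kappa> \<kappa>' :: "vertex \<Rightarrow> nat" and U U' :: "edge \<Rightarrow> real"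
      assume "\<And>e. e \<in> edges \<Longrightarrow> e \<subseteq> ?W \<Longrightarrow> U e = U' e"
      then have "U {u, v} = U' {u, v}"
        using True by force
      then show "(snd (\<kappa>, U) {u, v} \<le> t) = (snd (\<kappa>', U') {u, v} \<le> t)"
        by simp
    qed
    ultimately have "local_in ?W (\<lambda>s. {u, v} \<in> approx m (fst s) (snd s) \<and> snd s {u, v} \<le> t)"
      by (rule local_in_comp2)
    with True show ?thesis
      by (simp add: approx_open_def)
  next
    case False
    then have "\<not> ({u, v} \<in> approx_open t m s \<and> {u, v} \<subseteq> sup_ball x m)" for s
      using approx_subset_edges by (auto simp: approx_open_def)
    then show ?thesis
      by (simp only: local_in_const)
  qed
  then have "local_in ?W (\<lambda>s. (x, y) \<in> {(u, v). {u, v} \<in> approx_open t m s \<and> {u, v} \<subseteq> sup_ball x m}\<^sup>*)" for y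
    by (rule local_in_rtrancl)
  then have 1: "local_in ?W (\<lambda>s. sup_dist x y = int m \<and>
      (x, y) \<in> {(u, v). {u, v} \<in> approx_open t m s \<and> {u, v} \<subseteq> sup_ball x m}\<^sup>*)" for y
    by (rule local_in_comp2[OF local_in_const])
  have 2: "local_in ?W (\<lambda>s. e \<subseteq> sup_ball x m \<and> chain m (snd s) e)" for e
  proof (cases "e \<subseteq> sup_ball x m")
    case True
    then show ?thesis
      using local_in_mono[OF local_in_chain edge_nbhd_subset_ball] by simp
  qed (simp only: local_in_const simp_thms)
  show ?thesis
    unfolding good_def
  proof (rule local_in_disj)
    show "local_in ?W (\<lambda>s. \<exists>y. sup_dist x y = int m \<and>
        (x, y) \<in> {(u, v). {u, v} \<in> approx_open t m s \<and> {u, v} \<subseteq> sup_ball x m}\<^sup>*)"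
      by (rule local_in_Ex) (rule 1)
    show "local_in ?W (\<lambda>s. \<exists>e. e \<subseteq> sup_ball x m \<and> chain m (snd s) e)"
      by (rule local_in_Ex) (rule 2)
  qed
qed

lemma local_in_escape:
  assumes "\<And>v. v \<in> \<Lambda> \<Longrightarrow> sup_ball v (2 * m) \<subseteq> W"
  shows "local_in W (escape t m \<Lambda> n x)"
proof -
  have good: "local_in W (good t m v)" if "v \<in> \<Lambda>" for v
    using local_in_good assms[OF that] by (rule local_in_mono)
  have "local_in W (\<lambda>s. {u, v} \<in> edges \<and> {u, v} \<subseteq> \<Lambda> \<and> good t m u s \<and> good t m v s)" for u v
  proof (cases "{u, v} \<subseteq> \<Lambda>")
    case True
    then show ?thesis
      by (intro local_in_conj local_in_const good) auto
  qed (simp only: local_in_const simp_thms)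
  then have *: "local_in W (\<lambda>s. (x, y) \<in>
      {(u, v). {u, v} \<in> edges \<and> {u, v} \<subseteq> \<Lambda> \<and> good t m u s \<and> good t m v s}\<^sup>*)" for y
    by (rule local_in_rtrancl)
  show ?thesis
    unfolding escape_def by (rule local_in_Ex) (rule local_in_conj[OF local_in_const *])
qed

text \<open>\<open>x\<close> is good as the start of a nonempty path. The last entry point is at
  distance exactly \<open>R\<close>, so the far end is still at distance at least \<open>n\<close>
  from it.\<close>

lemma escape_decompose:
  assumes "escape t m UNIV (R + n) x s" "0 < R"
  shows "good t m x s \<and> (\<exists>z. sup_dist x z = int R \<and> escape t m {w. int R \<le> sup_dist x w} n z s)"
proof
  let ?r = "{(u, v). {u, v} \<in> edges \<and> {u, v} \<subseteq> UNIV \<and> good t m u s \<and> good t m v s}"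
  obtain y where y: "int (R + n) \<le> sup_dist x y" "(x, y) \<in> ?r\<^sup>*"
    using assms(1) unfolding escape_def by blast
  then have "x \<noteq> y"
    using \<open>0 < R\<close> by auto
  with y(2) show "good t m x s"
    by (auto elim: converse_rtranclE)
  have "{u, v} \<in> edges" if "(u, v) \<in> ?r" for u v
    using that by simp
  moreover have "int R \<le> sup_dist x y"
    using y(1) by simp
  ultimately obtain z where z: "sup_dist x z = int R"
    "(z, y) \<in> (?r \<inter> {w. int R \<le> sup_dist x w} \<times> {w. int R \<le> sup_dist x w})\<^sup>*"
    using last_entry[OF y(2)] by blast
  have far: "int n \<le> sup_dist z y"
    using sup_dist_triangle[of x y z] y(1) z(1) by simp
  have eq: "?r \<inter> {w. int R \<le> sup_dist x w} \<times> {w. int R \<le> sup_dist x w} =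
      {(u, v). {u, v} \<in> edges \<and> {u, v} \<subseteq> {w. int R \<le> sup_dist x w} \<and> good t m u s \<and> good t m v s}"
    by auto
  show "\<exists>z. sup_dist x z = int R \<and> escape t m {w. int R \<le> sup_dist x w} n z s"
    unfolding escape_def
    by (rule exI[of _ z], rule conjI, rule z(1), rule exI[of _ y], rule conjI, rule far,
      rule z(2)[unfolded eq])
qed

lemma escape_mono:
  assumes "escape t m \<Lambda> n x s" "\<Lambda> \<subseteq> \<Lambda>'" "n' \<le> n"
  shows "escape t m \<Lambda>' n' x s"
proof -
  let ?r = "\<lambda>\<Lambda>. {(u, v). {u, v} \<in> edges \<and> {u, v} \<subseteq> \<Lambda> \<and> good t m u s \<and> good t m v s}"
  obtain y where y: "int n \<le> sup_dist x y" "(x, y) \<in> (?r \<Lambda>)\<^sup>*"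
    using assms(1) unfolding escape_def by blast
  have "(?r \<Lambda>)\<^sup>* \<subseteq> (?r \<Lambda>')\<^sup>*"
    using assms(2) by (intro rtrancl_mono) auto
  then have "(x, y) \<in> (?r \<Lambda>')\<^sup>*"
    using y(2) by blast
  moreover have "int n' \<le> sup_dist x y"
    using y(1) assms(3) by simp
  ultimately show ?thesis
    unfolding escape_def by blast
qed

lemma cdp_config_iff: "e \<in> edges \<Longrightarrow> cdp_config t s e \<longleftrightarrow> snd s e \<le> t \<and> e \<in> successful (fst s) (snd s)"
  by (simp add: cdp_config_def case_prod_beta)

definition open_steps :: "real \<Rightarrow> sample \<Rightarrow> (vertex \<times> vertex) set" where
  "open_steps t s = {(u, v). {u, v} \<in> edges \<and> snd s {u, v} \<le> t \<and> {u, v} \<in> successful (fst s) (snd s)}"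

lemma open_connected_iff: "open_connected (cdp_config t s) x y \<longleftrightarrow> (x, y) \<in> (open_steps t s)\<^sup>*"
proof -
  have "{(u, v). {u, v} \<in> edges \<and> cdp_config t s {u, v}} = open_steps t s"
    by (auto simp: open_steps_def cdp_config_iff)
  then show ?thesis
    by (simp add: open_connected_def)
qed

lemma open_steps_edges: "(u, v) \<in> open_steps t s \<Longrightarrow> {u, v} \<in> edges"
  by (simp add: open_steps_def)

lemma sym_open_steps: "sym (open_steps t s)"
  by (auto simp: open_steps_def sym_def insert_commute)

lemma reach_eqI:
  assumes "(x, y) \<in> (open_steps t s)\<^sup>*" "int n \<le> sup_dist x y"
  shows "reach t n x s"
proof -
  obtain z where "sup_dist x z = int n" "(x, z) \<in> (open_steps t s \<inter> sup_ball x n \<times> sup_ball x n)\<^sup>*"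
    by (rule exit_ball[OF assms(1) open_steps_edges assms(2)])
  moreover have "(open_steps t s \<inter> sup_ball x n \<times> sup_ball x n)\<^sup>* \<subseteq> (open_steps t s)\<^sup>*"
    by (rule rtrancl_mono) simp
  ultimately show ?thesis
    unfolding reach_def open_connected_iff by blast
qed

lemma reach_antimono:
  assumes "reach t n x s" "n' \<le> n"
  shows "reach t n' x s"
proof -
  obtain y where "sup_dist x y = int n" "(x, y) \<in> (open_steps t s)\<^sup>*"
    using assms(1) unfolding reach_def open_connected_iff by blast
  then show ?thesis
    using assms(2) by (intro reach_eqI) auto
qed

text \<open>The set of successful edges does not involve the time, so in a fixed environment the
  open edges increase with \<open>t\<close>.\<close>

lemma reach_mono:
  assumes "reach t n x s" "t \<le> t'"
  shows "reach t' n x s"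
proof -
  have "(open_steps t s)\<^sup>* \<subseteq> (open_steps t' s)\<^sup>*"
    using assms(2) by (intro rtrancl_mono) (auto simp: open_steps_def)
  then show ?thesis
    using assms(1) unfolding reach_def open_connected_iff by blast
qed

text \<open>On the exceptional clocks no edge is open. Hence the passage from \<open>reach\<close>
  to \<open>escape\<close> holds for every sample, not just almost every one.\<close>

lemma reach_imp_wf:
  assumes "reach t n x s" "0 < n"
  shows "wf (earlier_adjacent (snd s))"
proof (rule ccontr)
  assume "\<not> wf (earlier_adjacent (snd s))"
  then have "open_steps t s = {}"
    by (simp add: open_steps_def successful_def)
  then show False
    using assms by (auto simp: reach_def open_connected_iff)
qed

text \<open>Without long chains near \<open>x\<close> the approximation is exact in the ball, and
  the open path up to its exit witnesses goodness; with such a chain goodness holds by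
  definition.\<close>

lemma open_connected_imp_good:
  assumes wf: "wf (earlier_adjacent (snd s))"
    and path: "(x, y) \<in> (open_steps t s)\<^sup>*" "int m \<le> sup_dist x y"
  shows "good t m x s"
proof (cases "\<exists>e. e \<subseteq> sup_ball x m \<and> chain m (snd s) e")
  case False
  obtain z where z: "sup_dist x z = int m" "(x, z) \<in> (open_steps t s \<inter> sup_ball x m \<times> sup_ball x m)\<^sup>*"
    by (rule exit_ball[OF path(1) open_steps_edges path(2)])
  have "open_steps t s \<inter> sup_ball x m \<times> sup_ball x m
      \<subseteq> {(u, v). {u, v} \<in> approx_open t m s \<and> {u, v} \<subseteq> sup_ball x m}"
  proof (rule subrelI)
    fix u v assume "(u, v) \<in> open_steps t s \<inter> sup_ball x m \<times> sup_ball x m"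
    then have uv: "(u, v) \<in> open_steps t s" "{u, v} \<subseteq> sup_ball x m"
      by simp_all
    then have "\<not> chain m (snd s) {u, v}"
      using False by blast
    then have "{u, v} \<in> approx_open t m s"
      using uv(1) approx_eq_successful[OF wf] by (simp add: open_steps_def approx_open_def)
    with uv(2) show "(u, v) \<in> {(u, v). {u, v} \<in> approx_open t m s \<and> {u, v} \<subseteq> sup_ball x m}"
      by simp
  qed
  from rtrancl_mono[OF this] z(2)
  have "(x, z) \<in> {(u, v). {u, v} \<in> approx_open t m s \<and> {u, v} \<subseteq> sup_ball x m}\<^sup>*"
    by (rule subsetD)
  with z(1) show ?thesis
    unfolding good_def by blast
qed (simp add: good_def)

text \<open>The converse comparison, by which the probability of being good is estimated through
  connection probabilities.\<close>

lemma good_imp_reach: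
  assumes wf: "wf (earlier_adjacent (snd s))" and good: "good t m x s"
    and no_chain: "\<not> (\<exists>e. e \<subseteq> sup_ball x m \<and> chain m (snd s) e)"
  shows "reach t m x s"
proof -
  obtain y where y: "sup_dist x y = int m"
    "(x, y) \<in> {(u, v). {u, v} \<in> approx_open t m s \<and> {u, v} \<subseteq> sup_ball x m}\<^sup>*"
    using good no_chain unfolding good_def by blast
  have "{(u, v). {u, v} \<in> approx_open t m s \<and> {u, v} \<subseteq> sup_ball x m} \<subseteq> open_steps t s"
  proof (rule subrelI)
    fix u v assume "(u, v) \<in> {(u, v). {u, v} \<in> approx_open t m s \<and> {u, v} \<subseteq> sup_ball x m}"
    then have uv: "{u, v} \<in> approx_open t m s" "{u, v} \<subseteq> sup_ball x m"
      by simp_all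
    then have "\<not> chain m (snd s) {u, v}" "{u, v} \<in> edges"
      using no_chain approx_subset_edges unfolding approx_open_def by blast+
    then show "(u, v) \<in> open_steps t s"
      using uv(1) approx_eq_successful[OF wf] by (simp add: open_steps_def approx_open_def)
  qed
  from rtrancl_mono[OF this] y(2) have "(x, y) \<in> (open_steps t s)\<^sup>*"
    by (rule subsetD)
  with y(1) show ?thesis
    unfolding reach_def open_connected_iff by blast
qed

text \<open>Every vertex of the path is connected to both ends. These are at least
  \<open>2 * m\<close> apart, so one of them is at distance at least \<open>m\<close> from the
  vertex.\<close>

lemma reach_imp_escape:
  assumes reach: "reach t n x s" and n: "2 * m \<le> n" "0 < n"
  shows "escape t m UNIV n x s"
proof -
  note wf = reach_imp_wf[OF reach n(2)]
  obtain y where y: "sup_dist x y = int n" "(x, y) \<in> (open_steps t s)\<^sup>*"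
    using reach unfolding reach_def open_connected_iff by blast
  have good: "good t m w s" if w: "(x, w) \<in> (open_steps t s)\<^sup>*" for w
  proof -
    have wx: "(w, x) \<in> (open_steps t s)\<^sup>*"
      using w sym_rtrancl[OF sym_open_steps] by (meson symD)
    then have wy: "(w, y) \<in> (open_steps t s)\<^sup>*"
      using y(2) by (rule rtrancl_trans)
    have "int m \<le> sup_dist w x \<or> int m \<le> sup_dist w y"
      using sup_dist_triangle[of x y w] sup_dist_commute[of x w] y(1) n by linarith
    then show ?thesis
      using open_connected_imp_good[OF wf] wx wy by blast
  qed
  let ?r = "{(u, v). {u, v} \<in> edges \<and> {u, v} \<subseteq> UNIV \<and> good t m u s \<and> good t m v s}"
  from y(2) have "(x, y) \<in> ?r\<^sup>*"
  proof induction
    case (step v w)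
    then have "{v, w} \<in> edges" "good t m v s" "good t m w s"
      by (blast intro: open_steps_edges good rtrancl_into_rtrancl)+
    then have "(v, w) \<in> ?r"
      by simp
    with step.IH show ?case
      by (rule rtrancl_into_rtrancl)
  qed simp
  moreover have "int n \<le> sup_dist x y"
    using y(1) by simp
  ultimately show ?thesis
    unfolding escape_def by blast
qed

subsection \<open>Translations\<close>

definition shift :: "vertex \<Rightarrow> edge \<Rightarrow> edge" where
  "shift a e = (\<lambda>v. v + a) ` e"

text \<open>The restrictions keep the result in the extensional product space and present it as a
  reindexing of coordinates. The origin in the translated sample sees what \<open>a\<close> sees in
  the original one.\<close>

definition translate :: "vertex \<Rightarrow> sample \<Rightarrow> sample" where
  "translate a = (\<lambda>(\<kappa>, U). (\<lambda>v\<in>UNIV. \<kappa> (v + a), \<lambda>e\<in>edges. U (shift a e)))"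

lemma shift_shift_minus [simp]: "shift a (shift (- a) e) = e" "shift (- a) (shift a e) = e"
  by (simp_all add: shift_def image_image)

lemma inj_shift: "inj (shift a)"
  by (metis injI shift_shift_minus(2))

lemma shift_mem_edges [simp]: "shift a e \<in> edges \<longleftrightarrow> e \<in> edges"
proof -
  have *: "shift a e \<in> edges" if "e \<in> edges" for a e
    using that by (rule edge_cases) (simp add: shift_def mem_edges_iff)
  show ?thesis
    using *[of e a] *[of "shift a e" "- a"] by auto
qed

lemma mem_shift_iff: "v + a \<in> shift a e \<longleftrightarrow> v \<in> e"
  by (auto simp: shift_def)

lemma approx_translate:
  assumes "e \<in> edges"
  shows "e \<in> approx k (fst (translate a s)) (snd (translate a s)) \<longleftrightarrow> shift a e \<in> approx k (fst s) (snd s)"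
  using assms
proof (induction k arbitrary: e)
  case (Suc k)
  let ?\<kappa>s = "fst s" and ?Us = "snd s"
  let ?\<kappa> = "fst (translate a s)" and ?U = "snd (translate a s)"
  have U: "?U f = ?Us (shift a f)" if "f \<in> edges" for f
    using that by (simp add: translate_def case_prod_beta)
  have \<kappa>: "?\<kappa> v = ?\<kappa>s (v + a)" for v
    by (simp add: translate_def case_prod_beta)
  have card: "card {f \<in> approx k ?\<kappa> ?U. v \<in> f \<and> ?U f < ?U e}
      = card {f \<in> approx k ?\<kappa>s ?Us. v + a \<in> f \<and> ?Us f < ?Us (shift a e)}" for v
  proof (rule bij_betw_same_card)
    show "bij_betw (shift a) {f \<in> approx k ?\<kappa> ?U. v \<in> f \<and> ?U f < ?U e}
        {f \<in> approx k ?\<kappa>s ?Us. v + a \<in> f \<and> ?Us f < ?Us (shift a e)}"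
      unfolding bij_betw_def
    proof (intro conjI equalityI subsetI)
      fix g assume g: "g \<in> {f \<in> approx k ?\<kappa>s ?Us. v + a \<in> f \<and> ?Us f < ?Us (shift a e)}"
      define f where "f = shift (- a) g"
      have "g = shift a f"
        by (simp add: f_def)
      moreover from this have "f \<in> edges"
        using g approx_subset_edges[of k ?\<kappa>s ?Us] by auto
      ultimately have "f \<in> {f \<in> approx k ?\<kappa> ?U. v \<in> f \<and> ?U f < ?U e}"
        using g Suc.IH[of f] Suc.prems U by (simp add: mem_shift_iff)
      with \<open>g = shift a f\<close> show "g \<in> shift a ` {f \<in> approx k ?\<kappa> ?U. v \<in> f \<and> ?U f < ?U e}"
        by blast
    next
      fix g assume "g \<in> shift a ` {f \<in> approx k ?\<kappa> ?U. v \<in> f \<and> ?U f < ?U e}"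
      then obtain f where "g = shift a f" "f \<in> approx k ?\<kappa> ?U" "v \<in> f" "?U f < ?U e" "f \<in> edges"
        using approx_subset_edges by blast
      then show "g \<in> {f \<in> approx k ?\<kappa>s ?Us. v + a \<in> f \<and> ?Us f < ?Us (shift a e)}"
        using Suc.IH[of f] Suc.prems U by (simp add: mem_shift_iff)
    qed (rule inj_on_subset[OF inj_shift], simp)
  qed
  have ball: "(\<forall>w\<in>shift a e. P w) \<longleftrightarrow> (\<forall>v\<in>e. P (v + a))" for P
    by (simp add: shift_def)
  show ?case
    by (simp only: approx.simps mem_Collect_eq shift_mem_edges ball card) (simp only: \<kappa>)
qed simp

lemma chain_translate:
  "chain k (snd s) e \<Longrightarrow> chain k (snd (translate a s)) (shift (- a) e)"
proof (induction k arbitrary: e)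
  case (Suc k)
  then obtain f where f: "(f, e) \<in> earlier_adjacent (snd s)" "chain k (snd s) f"
    by auto
  from f(1) obtain v where "v \<in> f" "v \<in> e"
    by (auto simp: earlier_adjacent_def)
  then have "v - a \<in> shift (- a) f \<inter> shift (- a) e"
    by (auto simp: shift_def)
  then have "(shift (- a) f, shift (- a) e) \<in> earlier_adjacent (snd (translate a s))"
    using f(1) by (auto simp: earlier_adjacent_def translate_def case_prod_beta)
  with Suc.IH[OF f(2)] show ?case
    by auto
qed simp

text \<open>Serves to bound the probability of being good at \<open>x\<close> by that at the origin,
  for which an inclusion of events suffices.\<close>

lemma good_translate:
  assumes "good t m x s"
  shows "good t m (0, 0) (translate x s)"
proof -
  have ball: "(\<lambda>v. v - x) ` e \<subseteq> sup_ball (0, 0) m" if "e \<subseteq> sup_ball x m" for e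
    using that sup_dist_add_right[of x "- x"] by (auto simp: zero_prod_def[symmetric] sup_dist_def subset_iff)
  from assms consider y where "sup_dist x y = int m"
    "(x, y) \<in> {(u, v). {u, v} \<in> approx_open t m s \<and> {u, v} \<subseteq> sup_ball x m}\<^sup>*"
    | e where "e \<subseteq> sup_ball x m" "chain m (snd s) e"
    unfolding good_def by blast
  then show ?thesis
  proof cases
    case 1
    let ?r = "{(u, v). {u, v} \<in> approx_open t m (translate x s) \<and> {u, v} \<subseteq> sup_ball (0, 0) m}"
    from 1(2) have "(x - x, y - x) \<in> ?r\<^sup>*"
    proof induction
      case (step u v)
      then have uv: "{u, v} \<in> approx_open t m s" "{u, v} \<subseteq> sup_ball x m"
        by simp_all
      have sh: "shift x {u - x, v - x} = {u, v}"
        by (simp add: shift_def)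
      then have e: "{u - x, v - x} \<in> edges"
        using uv(1) approx_subset_edges[of m "fst s" "snd s"] shift_mem_edges[of x "{u - x, v - x}"]
        unfolding approx_open_def by auto
      then have "snd (translate x s) {u - x, v - x} = snd s {u, v}"
        by (simp add: translate_def case_prod_beta sh)
      then have "{u - x, v - x} \<in> approx_open t m (translate x s)"
        using uv(1) approx_translate[OF e, of m x s] by (simp add: approx_open_def sh)
      moreover have "{u - x, v - x} \<subseteq> sup_ball (0, 0) m"
        using ball[OF uv(2)] by simp
      ultimately have "(u - x, v - x) \<in> ?r"
        by simp
      with step.IH show ?case
        by (rule rtrancl_into_rtrancl)
    qed simp
    then have "((0, 0), y - x) \<in> ?r\<^sup>*"
      by (simp add: zero_prod_def)
    moreover have "sup_dist (0, 0) (y - x) = int m"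
      using 1(1) by (simp add: sup_dist_def abs_minus_commute)
    ultimately show ?thesis
      unfolding good_def by blast
  next
    case 2
    then have "shift (- x) e \<subseteq> sup_ball (0, 0) m"
      using ball[of e] by (simp add: shift_def)
    with chain_translate[OF 2(2), of x] show ?thesis
      unfolding good_def by blast
  qed
qed

subsection \<open>Product measures\<close>

text \<open>
  Replacing the coordinates outside \<open>W\<close> by those of an independent copy does not change the law,
  and turns the product of two functions of disjoint coordinates into one of independent variables.
\<close>

lemma (in product_prob_space) distr_merge_copy:
  "distr (PiM I M \<Otimes>\<^sub>M PiM I M) (PiM I M) (\<lambda>(a, b). \<lambda>i\<in>I. if i \<in> W then a i else b i) = PiM I M"
proof (rule PiM_eq)
  let ?P = "PiM I M" and ?T = "\<lambda>(a, b). \<lambda>i\<in>I. if i \<in> W then a i else b i"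
  have T: "?T \<in> ?P \<Otimes>\<^sub>M ?P \<rightarrow>\<^sub>M ?P"
    unfolding case_prod_beta by (rule measurable_restrict) simp
  fix J F assume J: "finite J" "J \<subseteq> I" "\<And>j. j \<in> J \<Longrightarrow> F j \<in> sets (M j)"
  let ?A = "\<lambda>K. {x \<in> space ?P. \<forall>i\<in>K. x i \<in> F i}"
  have A: "emeasure ?P (?A K) = (\<Prod>i\<in>K. emeasure (M i) (F i))" "?A K \<in> sets ?P" if "K \<subseteq> J" for K
  proof -
    have K: "K \<subseteq> I" "finite K" "\<And>i. i \<in> K \<Longrightarrow> F i \<in> sets (M i)"
      using J that finite_subset by auto
    then show "emeasure ?P (?A K) = (\<Prod>i\<in>K. emeasure (M i) (F i))"
      by (rule emeasure_PiM_Collect)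
    show "?A K \<in> sets ?P"
      using K by (intro sets.sets_Collect_finite_All sets_Collect_single) auto
  qed
  have emb: "prod_emb I M J (Pi\<^sub>E J F) = ?A J"
    using J(2) by (auto simp: prod_emb_def space_PiM PiE_iff extensional_def)
  \<comment> \<open>The preimage of a finite cylinder is a rectangle: conditions on coordinates in
    \<open>W\<close> fall on the first copy, the others on the second.\<close>
  have "?T -` ?A J \<inter> space (?P \<Otimes>\<^sub>M ?P) = ?A (J \<inter> W) \<times> ?A (J - W)"
  proof (intro set_eqI)
    fix p :: "('i \<Rightarrow> 'a) \<times> ('i \<Rightarrow> 'a)"
    obtain a b where p: "p = (a, b)"
      by fastforce
    have "?T p i = (if i \<in> W then a i else b i)" if "i \<in> J" for i
      using that J(2) by (auto simp: p)
    then have "(\<forall>i\<in>J. ?T p i \<in> F i) \<longleftrightarrow> (\<forall>i\<in>J \<inter> W. a i \<in> F i) \<and> (\<forall>i\<in>J - W. b i \<in> F i)"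
      by auto
    then show "p \<in> ?T -` ?A J \<inter> space (?P \<Otimes>\<^sub>M ?P) \<longleftrightarrow> p \<in> ?A (J \<inter> W) \<times> ?A (J - W)"
      using measurable_space[OF T, of p] by (auto simp: p space_pair_measure)
  qed
  then have "emeasure (distr (?P \<Otimes>\<^sub>M ?P) ?P ?T) (?A J) = emeasure (?P \<Otimes>\<^sub>M ?P) (?A (J \<inter> W) \<times> ?A (J - W))"
    using A(2)[of J] by (simp add: emeasure_distr[OF T])
  also have "\<dots> = emeasure ?P (?A (J \<inter> W)) * emeasure ?P (?A (J - W))"
    by (intro emeasure_pair_measure_Times A) auto
  also have "\<dots> = (\<Prod>i\<in>J \<inter> W. emeasure (M i) (F i)) * (\<Prod>i\<in>J - W. emeasure (M i) (F i))"
    by (simp add: A(1))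
  also have "\<dots> = (\<Prod>i\<in>J. emeasure (M i) (F i))"
    using J(1) by (subst prod.union_disjoint[symmetric]) (auto intro: prod.cong)
  finally show "emeasure (distr (?P \<Otimes>\<^sub>M ?P) ?P ?T) (prod_emb I M J (Pi\<^sub>E J F)) =
      (\<Prod>j\<in>J. emeasure (M j) (F j))"
    by (simp only: emb)
qed simp

lemma (in product_prob_space) nn_integral_mult_disjoint_coordinates:
  assumes f[measurable]: "f \<in> borel_measurable (PiM I M)" and g[measurable]: "g \<in> borel_measurable (PiM I M)"
    and fW: "\<And>x y. (\<And>i. i \<in> I \<Longrightarrow> i \<in> W \<Longrightarrow> x i = y i) \<Longrightarrow> f x = f y"
    and gW: "\<And>x y. (\<And>i. i \<in> I \<Longrightarrow> i \<notin> W \<Longrightarrow> x i = y i) \<Longrightarrow> g x = g y"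
  shows "(\<integral>\<^sup>+ x. f x * g x \<partial>PiM I M) = (\<integral>\<^sup>+ x. f x \<partial>PiM I M) * (\<integral>\<^sup>+ x. g x \<partial>PiM I M)"
proof -
  let ?P = "PiM I M" and ?T = "\<lambda>(a, b). \<lambda>i\<in>I. if i \<in> W then a i else b i"
  have T[measurable]: "?T \<in> ?P \<Otimes>\<^sub>M ?P \<rightarrow>\<^sub>M ?P"
    unfolding case_prod_beta by (rule measurable_restrict) simp
  have "(\<integral>\<^sup>+ x. f x * g x \<partial>?P) = (\<integral>\<^sup>+ x. f x * g x \<partial>distr (?P \<Otimes>\<^sub>M ?P) ?P ?T)"
    by (simp only: distr_merge_copy)
  also have "\<dots> = (\<integral>\<^sup>+ p. f (?T p) * g (?T p) \<partial>(?P \<Otimes>\<^sub>M ?P))"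
    by (rule nn_integral_distr) simp_all
  also have "\<dots> = (\<integral>\<^sup>+ p. f (fst p) * g (snd p) \<partial>(?P \<Otimes>\<^sub>M ?P))"
  proof (rule nn_integral_cong)
    fix p
    have "f (?T p) = f (fst p)" "g (?T p) = g (snd p)"
      by (rule fW, simp add: case_prod_beta, rule gW, simp add: case_prod_beta)
    then show "f (?T p) * g (?T p) = f (fst p) * g (snd p)"
      by simp
  qed
  also have "\<dots> = (\<integral>\<^sup>+ a. \<integral>\<^sup>+ b. f a * g b \<partial>?P \<partial>?P)"
    by (subst nn_integral_fst[symmetric]) simp_all
  also have "\<dots> = (\<integral>\<^sup>+ x. f x \<partial>?P) * (\<integral>\<^sup>+ x. g x \<partial>?P)"
    by (simp add: nn_integral_cmult nn_integral_multc)
  finally show ?thesis .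
qed

text \<open>
  By exchangeability all orderings of the coordinates listed in \<open>es\<close> are equally likely, and they
  are mutually exclusive.
\<close>

lemma measure_decreasing_along_le:
  fixes N :: "real measure"
  assumes N: "prob_space N" "sets N = sets borel" and es: "distinct es" "set es \<subseteq> I"
  shows "measure (PiM I (\<lambda>_. N)) {U \<in> space (PiM I (\<lambda>_. N)). sorted_wrt (\<lambda>x y. y < x) (map U es)}
    \<le> 1 / fact (length es)"
proof -
  let ?P = "PiM I (\<lambda>_. N)" and ?n = "length es"
  let ?Q = "PiM {..<?n} (\<lambda>_. N)"
  interpret P: prob_space ?P
    by (rule prob_space_PiM) (rule N)
  define A where "A l = {U \<in> space ?P. sorted_wrt (\<lambda>x y. y < x) (map U l)}" for l
  define B where "B = {x \<in> space ?Q. \<forall>j\<in>{..<?n}. \<forall>i\<in>{..<?n}. i < j \<longrightarrow> x j < x i}"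
  have meas: "(\<lambda>x. x i) \<in> borel_measurable ?Q" if "i \<in> {..<?n}" for i
    using measurable_component_singleton[OF that, of "\<lambda>_. N"] N(2) by (simp cong: measurable_cong_sets)
  have B: "B \<in> sets ?Q"
    unfolding B_def using meas by measurable
  let ?L = "permutations_of_set (set es)"
  have L: "distinct l \<and> set l = set es \<and> length l = ?n" if "l \<in> ?L" for l
    using that es(1) by (auto simp: permutations_of_set_def) (metis distinct_card)
  have A: "A l \<in> sets ?P \<and> measure ?P (A l) = measure ?Q B" if "l \<in> ?L" for l
  proof -
    let ?f = "\<lambda>U. \<lambda>i\<in>{..<?n}. U (l ! i)"
    note l = L[OF that]
    have "inj_on ((!) l) {..<?n}" "(!) l \<in> {..<?n} \<rightarrow> I"
      using l es(2) by (auto simp: inj_on_def nth_eq_iff_index_eq)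
    \<comment> \<open>Reading coordinates along any injective list gives the same i.i.d. vector, so
      every ordering has the probability of the single event \<open>B\<close>.\<close>
    then have D: "distr ?P ?Q ?f = ?Q"
      using distr_PiM_reindex[of I "\<lambda>_. N" "(!) l" "{..<?n}"] N(1) by simp
    have f: "?f \<in> ?P \<rightarrow>\<^sub>M ?Q"
      using l es(2) by (intro measurable_restrict measurable_component_singleton) auto
    have "A l = ?f -` B \<inter> space ?P"
      using measurable_space[OF f] l
      by (auto simp: A_def B_def sorted_wrt_iff_nth_less)
    then show ?thesis
      using measurable_sets[OF f B] measure_distr[OF f B] D by simp
  qed
  have "disjoint_family_on A ?L"
    unfolding disjoint_family_on_def
  proof (intro ballI impI, rule ccontr)
    fix l l' assume l: "l \<in> ?L" "l' \<in> ?L" "l \<noteq> l'" and "A l \<inter> A l' \<noteq> {}"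
    then obtain U :: "'a \<Rightarrow> real" where "sorted_wrt (\<lambda>x y. y < x) (map U l)" "sorted_wrt (\<lambda>x y. y < x) (map U l')"
      by (auto simp: A_def)
    then have sorted: "sorted_wrt (<) (map U (rev l))" "sorted_wrt (<) (map U (rev l'))"
      by (simp_all add: sorted_wrt_rev flip: rev_map)
    \<comment> \<open>Both lists of values are strictly sorted with the same set, hence equal;
      \<open>U\<close> is injective there, so the lists themselves agree.\<close>
    then have "map U (rev l) = map U (rev l')"
      using strict_sorted_equal L[OF l(1)] L[OF l(2)] by (metis image_set set_rev)
    moreover have "inj_on U (set (rev l) \<union> set (rev l'))"
      using sorted(1)[THEN strict_sorted_iff[THEN iffD1]] L[OF l(1)] L[OF l(2)]
      by (simp add: distinct_map)
    ultimately have "rev l = rev l'"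
      by (rule map_inj_on)
    then show False
      using l(3) by simp
  qed
  then have "measure ?P (\<Union>l\<in>?L. A l) = (\<Sum>l\<in>?L. measure ?P (A l))"
    using A by (intro P.finite_measure_finite_Union) auto
  also have "\<dots> = fact ?n * measure ?Q B"
    using A es(1) by (simp add: distinct_card)
  \<comment> \<open>The disjoint events of the \<open>fact ?n\<close> orderings have total
    probability at most one; samples with ties lie outside all of them.\<close>
  finally have "fact ?n * measure ?Q B \<le> 1"
    using P.prob_le_1 by metis
  moreover have "es \<in> ?L"
    using es(1) by (simp add: permutations_of_set_def)
  ultimately show ?thesis
    using A[of es] by (simp add: A_def field_simps)
qed

subsection \<open>The environment\<close>

abbreviation clock_law :: "real measure" where
  "clock_law \<equiv> uniform_measure lborel {0<..1}"

abbreviation clocks :: "(edge \<Rightarrow> real) measure" where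
  "clocks \<equiv> PiM edges (\<lambda>_. clock_law)"

lemma prob_space_clock_law: "prob_space clock_law"
  by (rule prob_space_uniform_measure) simp_all

lemma prob_space_clocks: "prob_space clocks"
  by (rule prob_space_PiM) (rule prob_space_clock_law)

lemma prob_space_constraints: "prob_space (PiM UNIV (\<lambda>_. measure_pmf \<rho>))"
  by (rule prob_space_PiM) (rule prob_space_measure_pmf)

lemma prob_space_environment: "prob_space (environment \<rho>)"
proof -
  interpret pair_prob_space "PiM UNIV (\<lambda>_ :: vertex. measure_pmf \<rho>)" clocks
    by (intro pair_prob_space.intro pair_sigma_finite.intro prob_space_imp_sigma_finite
        prob_space_constraints prob_space_clocks)
  show ?thesis
    unfolding environment_def by (rule prob_space_axioms)
qed

lemma measurable_constraint [measurable]: "(\<lambda>s. fst s v) \<in> environment \<rho> \<rightarrow>\<^sub>M count_space UNIV"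
proof -
  have "(\<lambda>\<kappa>. \<kappa> v) \<in> PiM UNIV (\<lambda>_. measure_pmf \<rho>) \<rightarrow>\<^sub>M measure_pmf \<rho>"
    by (rule measurable_component_singleton) simp
  then have "(\<lambda>\<kappa>. \<kappa> v) \<in> PiM UNIV (\<lambda>_. measure_pmf \<rho>) \<rightarrow>\<^sub>M count_space UNIV"
    by simp
  then show ?thesis
    unfolding environment_def by (rule measurable_compose[OF measurable_fst])
qed

lemma measurable_clock [measurable]: "e \<in> edges \<Longrightarrow> (\<lambda>s. snd s e) \<in> borel_measurable (environment \<rho>)"
proof -
  assume "e \<in> edges"
  then have "(\<lambda>U. U e) \<in> clocks \<rightarrow>\<^sub>M clock_law"
    by (rule measurable_component_singleton)
  then have "(\<lambda>U. U e) \<in> borel_measurable clocks"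
    by (simp cong: measurable_cong_sets)
  then show ?thesis
    unfolding environment_def by (rule measurable_compose[OF measurable_snd])
qed

lemma emeasure_environment_clocks:
  assumes "{U \<in> space clocks. Q U} \<in> sets clocks"
  shows "emeasure (environment \<rho>) {s \<in> space (environment \<rho>). Q (snd s)} = emeasure clocks {U \<in> space clocks. Q U}"
proof -
  interpret K: prob_space "PiM UNIV (\<lambda>_ :: vertex. measure_pmf \<rho>)"
    by (rule prob_space_constraints)
  interpret U: prob_space clocks
    by (rule prob_space_clocks)
  have "{s \<in> space (environment \<rho>). Q (snd s)}
      = space (PiM UNIV (\<lambda>_ :: vertex. measure_pmf \<rho>)) \<times> {U \<in> space clocks. Q U}"
    by (auto simp: environment_def space_pair_measure)
  then show ?thesis
    unfolding environment_def
    by (simp only: U.emeasure_pair_measure_Times[OF sets.top assms] K.emeasure_space_1 mult_1)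
qed

text \<open>Fubini in two stages: for fixed constraints the product splits over disjoint sets of
  clocks, and the inner integrals then depend on disjoint sets of constraints.\<close>

lemma independent_if_local:
  fixes \<rho> :: "nat pmf"
  assumes Q: "Measurable.pred (environment \<rho>) Q" "Measurable.pred (environment \<rho>) Q'"
    and loc: "local_in W Q" "local_in W' Q'" and disj: "W \<inter> W' = {}"
  shows "measure (environment \<rho>) {s \<in> space (environment \<rho>). Q s \<and> Q' s} =
    measure (environment \<rho>) {s \<in> space (environment \<rho>). Q s} *
    measure (environment \<rho>) {s \<in> space (environment \<rho>). Q' s}"
proof -
  let ?E = "environment \<rho>" and ?K = "PiM UNIV (\<lambda>_ :: vertex. measure_pmf \<rho>)"
  interpret E: prob_space ?E
    by (rule prob_space_environment)
  interpret K: product_prob_space "\<lambda>_ :: vertex. measure_pmf \<rho>" UNIV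
    by (rule product_prob_spaceI) (rule prob_space_measure_pmf)
  interpret C: product_prob_space "\<lambda>_ :: edge. clock_law" edges
    by (rule product_prob_spaceI) (rule prob_space_clock_law)
  define f where "f s = (of_bool (Q s) :: ennreal)" for s
  define g where "g s = (of_bool (Q' s) :: ennreal)" for s
  have of_bool: "(\<lambda>s. of_bool (R s) :: ennreal) \<in> borel_measurable ?E" if "Measurable.pred ?E R" for R
    using that by (intro measurable_compose[OF that]) simp
  have fg[measurable]: "f \<in> borel_measurable (?K \<Otimes>\<^sub>M clocks)" "g \<in> borel_measurable (?K \<Otimes>\<^sub>M clocks)"
    using of_bool[OF Q(1)] of_bool[OF Q(2)] unfolding f_def g_def environment_def by simp_all
  have em: "emeasure ?E {s \<in> space ?E. R s} = (\<integral>\<^sup>+ s. of_bool (R s) \<partial>?E)" if "Measurable.pred ?E R" for R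
  proof -
    have "(\<integral>\<^sup>+ s. of_bool (R s) \<partial>?E) = (\<integral>\<^sup>+ s. indicator {s \<in> space ?E. R s} s \<partial>?E)"
      by (rule nn_integral_cong) (simp add: indicator_def)
    then show ?thesis
      using that by simp
  qed
  have f_local: "f (\<kappa>, U) = f (\<kappa>', U')"
    if "\<And>v. v \<in> W \<Longrightarrow> \<kappa> v = \<kappa>' v" "\<And>e. e \<in> edges \<Longrightarrow> e \<subseteq> W \<Longrightarrow> U e = U' e" for \<kappa> \<kappa>' U U'
    unfolding f_def using local_inD[OF loc(1) that] by simp
  have g_local: "g (\<kappa>, U) = g (\<kappa>', U')"
    if "\<And>v. v \<in> W' \<Longrightarrow> \<kappa> v = \<kappa>' v" "\<And>e. e \<in> edges \<Longrightarrow> e \<subseteq> W' \<Longrightarrow> U e = U' e" for \<kappa> \<kappa>' U U'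
    unfolding g_def using local_inD[OF loc(2) that] by simp
  have W': "v \<notin> W" if "v \<in> W'" for v
    using disj that by blast
  \<comment> \<open>Edges are nonempty, so none lies inside both regions. Edges that lie in neither
    are put on the side of \<open>W'\<close>.\<close>
  have edge_W': "\<not> e \<subseteq> W" if "e \<in> edges" "e \<subseteq> W'" for e
  proof -
    obtain u v where "e = {u, v}"
      using \<open>e \<in> edges\<close> by (rule edge_cases)
    then show ?thesis
      using that(2) W' by simp
  qed
  have "(\<integral>\<^sup>+ s. f s * g s \<partial>(?K \<Otimes>\<^sub>M clocks)) = (\<integral>\<^sup>+ \<kappa>. \<integral>\<^sup>+ U. f (\<kappa>, U) * g (\<kappa>, U) \<partial>clocks \<partial>?K)"
    by (subst C.P.nn_integral_fst[symmetric]) simp_all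
  also have "\<dots> = (\<integral>\<^sup>+ \<kappa>. (\<integral>\<^sup>+ U. f (\<kappa>, U) \<partial>clocks) * (\<integral>\<^sup>+ U. g (\<kappa>, U) \<partial>clocks) \<partial>?K)"
  proof (rule nn_integral_cong)
    fix \<kappa> assume [measurable]: "\<kappa> \<in> space ?K"
    show "(\<integral>\<^sup>+ U. f (\<kappa>, U) * g (\<kappa>, U) \<partial>clocks) = (\<integral>\<^sup>+ U. f (\<kappa>, U) \<partial>clocks) * (\<integral>\<^sup>+ U. g (\<kappa>, U) \<partial>clocks)"
    proof (rule C.nn_integral_mult_disjoint_coordinates[where W = "{e. e \<subseteq> W}"])
      show "f (\<kappa>, x) = f (\<kappa>, y)" if "\<And>i. i \<in> edges \<Longrightarrow> i \<in> {e. e \<subseteq> W} \<Longrightarrow> x i = y i" for x y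
        using that by (intro f_local) auto
      show "g (\<kappa>, x) = g (\<kappa>, y)" if "\<And>i. i \<in> edges \<Longrightarrow> i \<notin> {e. e \<subseteq> W} \<Longrightarrow> x i = y i" for x y
        using that edge_W' by (intro g_local) auto
    qed simp_all
  qed
  also have "\<dots> = (\<integral>\<^sup>+ \<kappa>. \<integral>\<^sup>+ U. f (\<kappa>, U) \<partial>clocks \<partial>?K) * (\<integral>\<^sup>+ \<kappa>. \<integral>\<^sup>+ U. g (\<kappa>, U) \<partial>clocks \<partial>?K)"
  proof (rule K.nn_integral_mult_disjoint_coordinates[where W = W])
    show "(\<integral>\<^sup>+ U. f (x, U) \<partial>clocks) = (\<integral>\<^sup>+ U. f (y, U) \<partial>clocks)"
      if "\<And>i. i \<in> UNIV \<Longrightarrow> i \<in> W \<Longrightarrow> x i = y i" for x y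
      using that by (intro nn_integral_cong f_local) auto
    show "(\<integral>\<^sup>+ U. g (x, U) \<partial>clocks) = (\<integral>\<^sup>+ U. g (y, U) \<partial>clocks)"
      if "\<And>i. i \<in> UNIV \<Longrightarrow> i \<notin> W \<Longrightarrow> x i = y i" for x y
      using that W' by (intro nn_integral_cong g_local) auto
  qed (simp_all add: C.P.borel_measurable_nn_integral_fst)
  also have "\<dots> = (\<integral>\<^sup>+ s. f s \<partial>(?K \<Otimes>\<^sub>M clocks)) * (\<integral>\<^sup>+ s. g s \<partial>(?K \<Otimes>\<^sub>M clocks))"
    by (simp add: C.P.nn_integral_fst)
  finally have "(\<integral>\<^sup>+ s. f s * g s \<partial>?E) = (\<integral>\<^sup>+ s. f s \<partial>?E) * (\<integral>\<^sup>+ s. g s \<partial>?E)"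
    by (simp add: environment_def)
  moreover have "f s * g s = of_bool (Q s \<and> Q' s)" for s
    by (simp add: f_def g_def)
  moreover have "Measurable.pred ?E (\<lambda>s. Q s \<and> Q' s)"
    using Q by simp
  ultimately have "emeasure ?E {s \<in> space ?E. Q s \<and> Q' s} = emeasure ?E {s \<in> space ?E. Q s} * emeasure ?E {s \<in> space ?E. Q' s}"
    using Q by (simp add: em f_def g_def)
  then show ?thesis
    by (simp add: measure_def enn2real_mult)
qed

lemma measurable_translate: "translate a \<in> environment \<rho> \<rightarrow>\<^sub>M environment \<rho>"
  and distr_translate: "distr (environment \<rho>) (environment \<rho>) (translate a) = environment \<rho>"
proof -
  let ?K = "PiM UNIV (\<lambda>_ :: vertex. measure_pmf \<rho>)"
  let ?f = "\<lambda>\<kappa> :: vertex \<Rightarrow> nat. \<lambda>v\<in>UNIV. \<kappa> (v + a)" and ?g = "\<lambda>U :: edge \<Rightarrow> real. \<lambda>e\<in>edges. U (shift a e)"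
  have f: "?f \<in> ?K \<rightarrow>\<^sub>M ?K" and g: "?g \<in> clocks \<rightarrow>\<^sub>M clocks"
    by (intro measurable_restrict measurable_component_singleton; simp)+
  have tr: "translate a = (\<lambda>(\<kappa>, U). (?f \<kappa>, ?g U))"
    by (simp add: translate_def)
  show "translate a \<in> environment \<rho> \<rightarrow>\<^sub>M environment \<rho>"
    unfolding environment_def tr using f g by measurable
  have df: "distr ?K ?K ?f = ?K"
    using distr_PiM_reindex[of UNIV "\<lambda>_. measure_pmf \<rho>" "\<lambda>v. v + a" UNIV]
    by (simp add: prob_space_measure_pmf)
  have dg: "distr clocks clocks ?g = clocks"
    using distr_PiM_reindex[of edges "\<lambda>_. clock_law" "shift a" edges]
    by (simp add: prob_space_clock_law inj_on_subset[OF inj_shift] Pi_iff)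
  have "distr ?K ?K ?f \<Otimes>\<^sub>M distr clocks clocks ?g = distr (?K \<Otimes>\<^sub>M clocks) (?K \<Otimes>\<^sub>M clocks) (\<lambda>(x, y). (?f x, ?g y))"
    by (rule pair_measure_distr[OF f g]) (simp only: dg prob_space_clocks prob_space_imp_sigma_finite)
  then show "distr (environment \<rho>) (environment \<rho>) (translate a) = environment \<rho>"
    unfolding environment_def tr df dg by simp
qed

subsection \<open>Measurability\<close>

text \<open>The type of edges is a power set and uncountable; the countable union is over the set
  \<open>edges\<close>.\<close>

lemma pred_Bex_edges:
  assumes "\<And>e. e \<in> edges \<Longrightarrow> Measurable.pred M (P e)"
  shows "Measurable.pred M (\<lambda>x. \<exists>e\<in>edges. P e x)"
proof -
  have "{x \<in> space M. \<exists>e\<in>edges. P e x} = (\<Union>e\<in>edges. {x \<in> space M. P e x})"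
    by auto
  also have "\<dots> \<in> sets M"
    using assms by (intro sets.countable_UN'[OF countable_edges]) (auto simp: pred_def)
  finally show ?thesis
    by (simp add: pred_def)
qed

lemma pred_Ball_edges:
  assumes "\<And>e. e \<in> edges \<Longrightarrow> Measurable.pred M (P e)"
  shows "Measurable.pred M (\<lambda>x. \<forall>e\<in>edges. P e x)"
  using pred_intros_logic(2)[OF pred_Bex_edges[OF pred_intros_logic(2)[OF assms]]] by simp

text \<open>Reachability is a countable union over path lengths and, at each length, over the last
  intermediate point.\<close>

lemma pred_rtrancl:
  fixes P :: "'a :: countable \<Rightarrow> 'a \<Rightarrow> 's \<Rightarrow> bool"
  assumes P[measurable]: "\<And>x y. Measurable.pred M (P x y)"
  shows "Measurable.pred M (\<lambda>s. (x, y) \<in> {(u, v). P u v s}\<^sup>*)"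
proof -
  have "Measurable.pred M (\<lambda>s. (x, y) \<in> {(u, v). P u v s} ^^ n)" for n y
  proof (induction n arbitrary: y)
    case (Suc n)
    have "(\<lambda>s. (x, y) \<in> {(u, v). P u v s} ^^ Suc n) = (\<lambda>s. \<exists>z. (x, z) \<in> {(u, v). P u v s} ^^ n \<and> P z y s)"
      by (auto simp: relcomp_unfold)
    moreover have "Measurable.pred M (\<lambda>s. \<exists>z. (x, z) \<in> {(u, v). P u v s} ^^ n \<and> P z y s)"
      by (intro pred_intros_countable pred_intros_logic Suc.IH P)
    ultimately show ?case
      by (simp only:)
  qed simp
  then show ?thesis
    unfolding rtrancl_power by (intro pred_intros_countable)
qed

lemma pred_approx: "Measurable.pred (environment \<rho>) (\<lambda>s. e \<in> approx k (fst s) (snd s))"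
proof (induction k arbitrary: e)
  case (Suc k)
  show ?case
  proof (cases "e \<in> edges")
    case True
    \<comment> \<open>The count of earlier open edges at \<open>v\<close> is a sum of indicators
      over the fixed finite set \<open>incident v\<close>, hence measurable.\<close>
    have "card {f \<in> approx k (fst s) (snd s). v \<in> f \<and> snd s f < snd s e} =
        (\<Sum>f\<in>incident v. of_bool (f \<in> approx k (fst s) (snd s) \<and> snd s f < snd s e))" for s v
    proof -
      have "{f \<in> approx k (fst s) (snd s). v \<in> f \<and> snd s f < snd s e} =
          incident v \<inter> {f. f \<in> approx k (fst s) (snd s) \<and> snd s f < snd s e}"
        using approx_subset_edges[of k "fst s" "snd s"] by (auto simp: incident_def)
      then show ?thesis
        using card_eq_sum[of "incident v \<inter> {f. f \<in> approx k (fst s) (snd s) \<and> snd s f < snd s e}"]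
        by (simp only: sum.inter_restrict[OF finite_incident] mem_Collect_eq of_bool_def)
    qed
    then have "(\<lambda>s. e \<in> approx (Suc k) (fst s) (snd s)) = (\<lambda>s. \<forall>v\<in>e.
        real (\<Sum>f\<in>incident v. of_bool (f \<in> approx k (fst s) (snd s) \<and> snd s f < snd s e)) < real (fst s v))"
      using True by (simp del: of_nat_sum)
    moreover have "Measurable.pred (environment \<rho>) (\<lambda>s. \<forall>v\<in>e.
        real (\<Sum>f\<in>incident v. of_bool (f \<in> approx k (fst s) (snd s) \<and> snd s f < snd s e)) < real (fst s v))"
    proof (intro pred_intros_finite finite_edge[OF True])
      fix v
      have "Measurable.pred (environment \<rho>) (\<lambda>s. f \<in> approx k (fst s) (snd s) \<and> snd s f < snd s e)"
        if "f \<in> incident v" for f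
      proof -
        have "f \<in> edges"
          using that by (simp add: incident_def)
        then show ?thesis
          using Suc.IH[of f] measurable_clock[OF True] measurable_clock[of f] by measurable
      qed
      then have *: "(\<lambda>s. of_bool (f \<in> approx k (fst s) (snd s) \<and> snd s f < snd s e) :: real)
          \<in> borel_measurable (environment \<rho>)" if "f \<in> incident v" for f
        using measurable_compose[where g = "of_bool :: bool \<Rightarrow> real" and L = borel] that by fastforce
      have "(\<lambda>s. \<Sum>f\<in>incident v. of_bool (f \<in> approx k (fst s) (snd s) \<and> snd s f < snd s e) :: real)
          \<in> borel_measurable (environment \<rho>)"
        by (rule borel_measurable_sum) (rule *)
      moreover have "(\<lambda>s. real (fst s v)) \<in> borel_measurable (environment \<rho>)"
        by (rule measurable_compose[OF measurable_constraint]) simp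
      ultimately show "Measurable.pred (environment \<rho>) (\<lambda>s.
          real (\<Sum>f\<in>incident v. of_bool (f \<in> approx k (fst s) (snd s) \<and> snd s f < snd s e)) < real (fst s v))"
        unfolding of_nat_sum of_nat_of_bool by (rule borel_measurable_pred_less)
    qed
    ultimately show ?thesis
      by (simp only:)
  qed simp
qed simp

lemma pred_chain: "Measurable.pred (environment \<rho>) (\<lambda>s. chain k (snd s) e)"
proof (induction k arbitrary: e)
  case (Suc k)
  have "(\<lambda>s :: sample. chain (Suc k) (snd s) e) =
      (\<lambda>s. \<exists>f\<in>edges. e \<in> edges \<and> f \<inter> e \<noteq> {} \<and> snd s f < snd s e \<and> chain k (snd s) f)"
    unfolding chain.simps earlier_adjacent_def by auto
  moreover have "Measurable.pred (environment \<rho>)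
      (\<lambda>s. \<exists>f\<in>edges. e \<in> edges \<and> f \<inter> e \<noteq> {} \<and> snd s f < snd s e \<and> chain k (snd s) f)"
  proof (intro pred_Bex_edges pred_intros_conj1')
    fix f assume "f \<in> edges" "e \<in> edges"
    then show "Measurable.pred (environment \<rho>) (\<lambda>s. snd s f < snd s e \<and> chain k (snd s) f)"
      using Suc.IH[of f] measurable_clock[of e] measurable_clock[of f] by measurable
  qed
  ultimately show ?case
    by (simp only:)
qed simp

lemma pred_successful: "Measurable.pred (environment \<rho>) (\<lambda>s. e \<in> successful (fst s) (snd s))"
  unfolding successful_iff
  by (intro pred_intros_logic(2,3) pred_intros_conj1' pred_intros_countable(2) pred_Ball_edges
      pred_chain pred_approx)

lemma pred_open_step:
  "Measurable.pred (environment \<rho>) (\<lambda>s. {u, v} \<in> edges \<and> snd s {u, v} \<le> t \<and> {u, v} \<in> successful (fst s) (snd s))"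
proof (rule pred_intros_conj1')
  assume "{u, v} \<in> edges"
  then show "Measurable.pred (environment \<rho>) (\<lambda>s. snd s {u, v} \<le> t \<and> {u, v} \<in> successful (fst s) (snd s))"
    using measurable_clock[of "{u, v}"] pred_successful[where \<rho> = \<rho> and e = "{u, v}"] by measurable
qed

lemma pred_reach: "Measurable.pred (environment \<rho>) (reach t n x)"
  unfolding reach_def open_connected_iff open_steps_def
  by (intro pred_intros_countable pred_intros_conj1' pred_rtrancl pred_open_step)

lemma pred_approx_open_step:
  "Measurable.pred (environment \<rho>) (\<lambda>s. {u, v} \<in> approx_open t m s \<and> {u, v} \<subseteq> \<Lambda>)"
proof (cases "{u, v} \<in> edges")
  case True
  then show ?thesis
    using measurable_clock[of "{u, v}"] pred_approx[where \<rho> = \<rho> and e = "{u, v}" and k = m]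
    unfolding approx_open_def by measurable
next
  case False
  then have "{u, v} \<notin> approx_open t m s" for s
    using approx_subset_edges[of m "fst s" "snd s"] by (auto simp: approx_open_def)
  then show ?thesis
    by simp
qed

lemma pred_good: "Measurable.pred (environment \<rho>) (good t m x)"
proof -
  have "(\<lambda>s :: sample. \<exists>e. e \<subseteq> sup_ball x m \<and> chain m (snd s) e) =
      (\<lambda>s. \<exists>e\<in>edges. e \<subseteq> sup_ball x m \<and> chain m (snd s) e)"
    using chain_edge by blast
  moreover have "Measurable.pred (environment \<rho>) (\<lambda>s. \<exists>e\<in>edges. e \<subseteq> sup_ball x m \<and> chain m (snd s) e)"
    by (intro pred_Bex_edges pred_intros_conj1' pred_chain)
  ultimately have chain: "Measurable.pred (environment \<rho>) (\<lambda>s. \<exists>e. e \<subseteq> sup_ball x m \<and> chain m (snd s) e)"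
    by (simp only:)
  show ?thesis
    unfolding good_def
    by (intro pred_intros_logic chain pred_intros_countable pred_intros_conj1' pred_rtrancl pred_approx_open_step)
qed

lemma pred_escape: "Measurable.pred (environment \<rho>) (escape t m \<Lambda> n x)"
  unfolding escape_def
  by (intro pred_intros_countable pred_intros_conj1' pred_rtrancl pred_intros_logic pred_good)

lemma measurable_cdp_config:
  "cdp_config t \<in> environment \<rho> \<rightarrow>\<^sub>M PiM edges (\<lambda>_. count_space UNIV)"
  unfolding cdp_config_def case_prod_beta
proof (rule measurable_restrict)
  fix e assume "e \<in> edges"
  then show "(\<lambda>s. snd s e \<le> t \<and> e \<in> successful (fst s) (snd s)) \<in> environment \<rho> \<rightarrow>\<^sub>M count_space UNIV"
    using measurable_clock[of e] pred_successful[where \<rho> = \<rho> and e = e] by measurable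
qed

lemma sets_connection:
  "{\<omega> \<in> space (PiM edges (\<lambda>_. count_space UNIV)). \<exists>x\<in>box_boundary n. open_connected \<omega> (0, 0) x}
    \<in> sets (PiM edges (\<lambda>_. count_space UNIV))"
proof -
  let ?N = "PiM edges (\<lambda>_. count_space UNIV) :: (edge \<Rightarrow> bool) measure"
  have "Measurable.pred ?N (\<lambda>\<omega>. {u, v} \<in> edges \<and> \<omega> {u, v})" for u v
    by (intro pred_intros_conj1' measurable_component_singleton)
  then have "Measurable.pred ?N (\<lambda>\<omega>. \<exists>x\<in>box_boundary n. open_connected \<omega> (0, 0) x)"
    unfolding open_connected_def by (intro pred_intros_countable_bounded pred_rtrancl) simp
  then show ?thesis
    by (simp add: pred_def)
qed

lemma connection_prob_eq:
  "connection_prob \<rho> t n = measure (environment \<rho>) {s \<in> space (environment \<rho>). reach t n (0, 0) s}"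
proof -
  let ?N = "PiM edges (\<lambda>_. count_space UNIV) :: (edge \<Rightarrow> bool) measure"
  let ?A = "{\<omega> \<in> space ?N. \<exists>x\<in>box_boundary n. open_connected \<omega> (0, 0) x}"
  have "connection_prob \<rho> t n = measure (environment \<rho>) (cdp_config t -` ?A \<inter> space (environment \<rho>))"
    unfolding connection_prob_def cdpre_def space_distr
    by (rule measure_distr[OF measurable_cdp_config sets_connection])
  also have "cdp_config t -` ?A \<inter> space (environment \<rho>) = {s \<in> space (environment \<rho>). reach t n (0, 0) s}"
    using measurable_space[OF measurable_cdp_config, of _ \<rho> t]
    by (auto simp: reach_def box_boundary_eq_sphere)
  finally show ?thesis .
qed

subsection \<open>Decreasing chains are short\<close>

text \<open>Walks may stay put or return, which keeps the count simple; along a walk that repeats an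
  edge the clocks never decrease strictly.\<close>

primrec walks :: "nat \<Rightarrow> edge \<Rightarrow> edge list set" where
  "walks 0 e = {[e]}"
| "walks (Suc k) e = (\<Union>f\<in>touching e. (#) e ` walks k f)"

lemma walks_props:
  assumes "e \<in> edges"
  shows "finite (walks k e) \<and> card (walks k e) \<le> 8 ^ k \<and>
    (\<forall>es\<in>walks k e. length es = Suc k \<and> hd es = e \<and> set es \<subseteq> edges)"
  using assms
proof (induction k arbitrary: e)
  case (Suc k)
  have IH: "finite (walks k f)" "card (walks k f) \<le> 8 ^ k"
    "\<forall>es\<in>walks k f. length es = Suc k \<and> hd es = f \<and> set es \<subseteq> edges" if "f \<in> touching e" for f
    using Suc.IH[of f] that by (auto simp: touching_def)
  have "card (walks (Suc k) e) \<le> (\<Sum>f\<in>touching e. card ((#) e ` walks k f))"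
    unfolding walks.simps by (rule card_UN_le) (rule finite_touching[OF Suc.prems])
  also have "\<dots> \<le> (\<Sum>f\<in>touching e. 8 ^ k)"
    using IH by (intro sum_mono) (meson card_image_le order_trans)
  also have "\<dots> \<le> 8 ^ Suc k"
    using card_touching_le[OF Suc.prems] by simp
  finally have "card (walks (Suc k) e) \<le> 8 ^ Suc k" .
  then show ?case
    using IH finite_touching[OF Suc.prems] Suc.prems by auto
qed simp

lemma chain_imp_decreasing_walk:
  "chain k U e \<Longrightarrow> \<exists>es\<in>walks k e. sorted_wrt (\<lambda>x y. y < x) (map U es)"
proof (induction k arbitrary: e)
  case (Suc k)
  then obtain f where f: "(f, e) \<in> earlier_adjacent U" "chain k U f"
    by auto
  then obtain es where es: "es \<in> walks k f" "sorted_wrt (\<lambda>x y. y < x) (map U es)"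
    using Suc.IH by blast
  have fe: "f \<in> touching e" "f \<in> edges" "U f < U e"
    using f(1) by (auto simp: earlier_adjacent_def touching_def)
  obtain es' where es': "es = f # es'"
    using walks_props[OF fe(2), of k] es(1) by (cases es) auto
  have "sorted_wrt (\<lambda>x y. y < x) (map U (e # es))"
    using es(2) fe(3) by (auto simp: es')
  with es(1) fe(1) show ?case
    by auto
qed simp

text \<open>Union bound over the at most \<open>8 ^ k\<close> walks from \<open>e\<close>, each with
  \<open>k + 1\<close> edges.\<close>

lemma measure_chain_le:
  "measure (environment \<rho>) {s \<in> space (environment \<rho>). chain k (snd s) e} \<le> 8 ^ k / fact (Suc k)"
proof (cases "e \<in> edges")
  case False
  then have "{s \<in> space (environment \<rho>). chain k (snd s) e} = {}"
    using chain_edge by blast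
  then show ?thesis
    by (simp only: measure_empty) simp
next
  case True
  interpret E: prob_space "environment \<rho>"
    by (rule prob_space_environment)
  note walks = walks_props[OF True, of k]
  define A where "A es = {s \<in> space (environment \<rho>). sorted_wrt (\<lambda>x y. y < x) (map (snd s) es)}" for es
  have A: "A es \<in> sets (environment \<rho>) \<and> measure (environment \<rho>) (A es) \<le> 1 / fact (Suc k)"
    if "es \<in> walks k e" for es
  proof (cases "distinct es")
    case True
    have es: "length es = Suc k" "set es \<subseteq> edges"
      using walks that by auto
    let ?C = "{U \<in> space clocks. sorted_wrt (\<lambda>x y. y < x) (map U es)}"
    have "(\<lambda>U. U f) \<in> borel_measurable clocks" if "f \<in> edges" for f
      using measurable_component_singleton[OF that, of "\<lambda>_. clock_law"] by (simp cong: measurable_cong_sets)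
    then have meas: "(\<lambda>U. U (es ! i)) \<in> borel_measurable clocks" if "i \<in> {..<length es}" for i
      using es(2) that by (meson lessThan_iff nth_mem subsetD)
    have "?C = {U \<in> space clocks. \<forall>j\<in>{..<length es}. \<forall>i\<in>{..<length es}. i < j \<longrightarrow> U (es ! j) < U (es ! i)}"
      by (auto simp: sorted_wrt_iff_nth_less)
    also have "\<dots> \<in> sets clocks"
      using meas by measurable
    finally have C: "?C \<in> sets clocks" .
    have "A es = snd -` ?C \<inter> space (environment \<rho>)"
      by (auto simp: A_def environment_def space_pair_measure)
    then have "A es \<in> sets (environment \<rho>)"
      using measurable_sets[OF measurable_snd C] by (simp add: environment_def)
    moreover have "measure (environment \<rho>) (A es) = measure clocks ?C"
      using emeasure_environment_clocks[OF C, of \<rho>] by (simp add: A_def measure_def)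
    ultimately show ?thesis
      using measure_decreasing_along_le[OF prob_space_clock_law _ True es(2)] es(1) by simp
  next
    case False
    have "distinct es" if "s \<in> A es" for s
    proof -
      have "sorted_wrt (<) (rev (map (snd s) es))"
        using that by (simp add: A_def sorted_wrt_rev)
      then show "distinct es"
        by (simp add: strict_sorted_iff distinct_map)
    qed
    then have "A es = {}"
      using False by blast
    then show ?thesis
      by simp
  qed
  have "measure (environment \<rho>) {s \<in> space (environment \<rho>). chain k (snd s) e}
      \<le> measure (environment \<rho>) (\<Union>es\<in>walks k e. A es)"
    using chain_imp_decreasing_walk A walks
    by (intro E.finite_measure_mono) (auto simp: A_def)
  also have "\<dots> \<le> (\<Sum>es\<in>walks k e. measure (environment \<rho>) (A es))"
    using A walks by (intro E.finite_measure_subadditive_finite) auto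
  also have "\<dots> \<le> (\<Sum>es\<in>walks k e. 1 / fact (Suc k))"
    using A by (intro sum_mono) auto
  also have "\<dots> \<le> 8 ^ k / fact (Suc k)"
    using walks by (simp add: field_simps del: fact_Suc)
  finally show ?thesis .
qed

lemma power_8_over_fact_tendsto: "(\<lambda>k. 8 ^ k / fact k :: real) \<longlonglongrightarrow> 0"
  using summable_LIMSEQ_zero[OF summable_exp[of "8 :: real"]] by (simp add: field_simps)

text \<open>The factorial beats the number of walks, so almost surely no given edge has chains of
  every length; there are countably many edges.\<close>

lemma AE_wf_earlier_adjacent: "AE s in environment \<rho>. wf (earlier_adjacent (snd s))"
proof -
  interpret E: prob_space "environment \<rho>"
    by (rule prob_space_environment)
  have "AE s in environment \<rho>. \<exists>k. \<not> chain k (snd s) e" for e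
  proof -
    let ?A = "{s \<in> space (environment \<rho>). \<not> (\<exists>k. \<not> chain k (snd s) e)}"
    have "measure (environment \<rho>) ?A \<le> 8 ^ k / fact k" for k
    proof -
      have "measure (environment \<rho>) ?A \<le> measure (environment \<rho>) {s \<in> space (environment \<rho>). chain k (snd s) e}"
        using pred_chain[where \<rho> = \<rho> and k = k and e = e] by (intro E.finite_measure_mono) (auto simp: pred_def)
      also have "\<dots> \<le> 8 ^ k / fact (Suc k)"
        by (rule measure_chain_le)
      also have "\<dots> \<le> 8 ^ k / fact k"
        by (intro divide_left_mono) (simp_all add: fact_mono_nat del: fact_Suc, simp add: fact_mono)
      finally show ?thesis .
    qed
    then have "measure (environment \<rho>) ?A \<le> 0"
      using power_8_over_fact_tendsto by (intro LIMSEQ_le_const) auto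
    then have "measure (environment \<rho>) ?A = 0"
      by (simp add: measure_le_0_iff)
    moreover have "?A \<in> sets (environment \<rho>)"
      unfolding pred_def[symmetric] by (intro pred_intros_logic pred_intros_countable pred_chain)
    ultimately show ?thesis
      by (intro AE_I[of _ _ ?A]) (auto simp: E.emeasure_eq_measure)
  qed
  then show ?thesis
    unfolding wf_earlier_adjacent_iff by (simp add: AE_ball_countable)
qed

subsection \<open>Decay of the finite-range process\<close>

text \<open>The second summand is a union bound over chains from the edges in the ball. Without such
  a chain goodness means a true connection, once the clocks are well-founded; this makes the
  inclusion of events an almost sure one.\<close>

lemma measure_good_le:
  "measure (environment \<rho>) {s \<in> space (environment \<rho>). good t m x s} \<le>
    connection_prob \<rho> t m + 4 * (2 * real m + 1)\<^sup>2 * (8 ^ m / fact (Suc m))"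
proof -
  let ?E = "environment \<rho>"
  interpret E: prob_space ?E
    by (rule prob_space_environment)
  have sets: "{s \<in> space ?E. P s} \<in> sets ?E" if "Measurable.pred ?E P" for P
    using that by (simp add: pred_def)
  let ?G = "{s \<in> space ?E. good t m (0, 0) s}"
  have "measure ?E {s \<in> space ?E. good t m x s} \<le> measure ?E (translate x -` ?G \<inter> space ?E)"
  proof (rule E.finite_measure_mono)
    show "{s \<in> space ?E. good t m x s} \<subseteq> translate x -` ?G \<inter> space ?E"
      using measurable_space[OF measurable_translate] good_translate by blast
  qed (rule measurable_sets[OF measurable_translate sets[OF pred_good]])
  also have "\<dots> = measure ?E ?G"
    using measure_distr[OF measurable_translate sets[OF pred_good]] by (simp only: distr_translate)
  also have "\<dots> \<le> measure ?E ({s \<in> space ?E. reach t m (0, 0) s} \<union>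
      (\<Union>e\<in>{e \<in> edges. e \<subseteq> sup_ball (0, 0) m}. {s \<in> space ?E. chain m (snd s) e}))"
  proof (rule E.finite_measure_mono_AE)
    show "AE s in ?E. s \<in> ?G \<longrightarrow> s \<in> {s \<in> space ?E. reach t m (0, 0) s} \<union>
        (\<Union>e\<in>{e \<in> edges. e \<subseteq> sup_ball (0, 0) m}. {s \<in> space ?E. chain m (snd s) e})"
      using AE_wf_earlier_adjacent
    proof eventually_elim
      case (elim s)
      then show ?case
        using good_imp_reach[of s t m "(0, 0)"] chain_edge by blast
    qed
  qed (intro sets.Un sets.finite_UN finite_edges_in_ball sets pred_reach pred_chain)
  also have "\<dots> \<le> measure ?E {s \<in> space ?E. reach t m (0, 0) s} +
      measure ?E (\<Union>e\<in>{e \<in> edges. e \<subseteq> sup_ball (0, 0) m}. {s \<in> space ?E. chain m (snd s) e})"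
    by (intro measure_Un_le sets.finite_UN finite_edges_in_ball sets pred_reach pred_chain)
  also have "measure ?E (\<Union>e\<in>{e \<in> edges. e \<subseteq> sup_ball (0, 0) m}. {s \<in> space ?E. chain m (snd s) e})
      \<le> (\<Sum>e\<in>{e \<in> edges. e \<subseteq> sup_ball (0, 0) m}. measure ?E {s \<in> space ?E. chain m (snd s) e})"
    using sets[OF pred_chain] by (intro E.finite_measure_subadditive_finite finite_edges_in_ball) auto
  also have "\<dots> \<le> (\<Sum>e\<in>{e \<in> edges. e \<subseteq> sup_ball (0, 0) m}. 8 ^ m / fact (Suc m))"
    by (intro sum_mono measure_chain_le)
  also have "\<dots> = real (card {e \<in> edges. e \<subseteq> sup_ball (0, 0) m}) * (8 ^ m / fact (Suc m))"
    by simp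
  also have "\<dots> \<le> real (4 * (2 * m + 1)\<^sup>2) * (8 ^ m / fact (Suc m))"
    using card_edges_in_ball_le[of "(0, 0)" m] by (intro mult_right_mono) (simp_all only: of_nat_le_iff, simp)
  finally show ?thesis
    by (simp add: connection_prob_eq add.commute)
qed

text \<open>
  After its last entry into the complement of the ball of radius \<open>R\<close> around \<open>x\<close>, a path of good
  vertices only uses vertices whose goodness is independent of that of \<open>x\<close>.
\<close>

lemma measure_escape_le:
  assumes p: "\<And>x. measure (environment \<rho>) {s \<in> space (environment \<rho>). good t m x s} \<le> p"
    and R: "R = 4 * m + 1"
  shows "measure (environment \<rho>) {s \<in> space (environment \<rho>). escape t m UNIV (j * R) x s}
    \<le> (4 * (2 * real R + 1) * p) ^ j"
proof (induction j arbitrary: x)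
  case 0
  show ?case
    by (simp add: prob_space.prob_le_1[OF prob_space_environment])
next
  case (Suc j)
  let ?E = "environment \<rho>" and ?q = "4 * (2 * real R + 1) * p"
  interpret E: prob_space ?E
    by (rule prob_space_environment)
  have sets: "{s \<in> space ?E. P s} \<in> sets ?E" if "Measurable.pred ?E P" for P
    using that by (simp add: pred_def)
  have p0: "0 \<le> p"
    using p[of x] measure_nonneg order_trans by blast
  let ?S = "{z. sup_dist x z = int R}" and ?\<Lambda> = "{w. int R \<le> sup_dist x w}"
  have finS: "finite ?S"
    by (rule finite_subset[OF _ finite_sup_ball[of x "int R"]]) auto
  have indep: "measure ?E {s \<in> space ?E. good t m x s \<and> escape t m ?\<Lambda> (j * R) z s} =
      measure ?E {s \<in> space ?E. good t m x s} * measure ?E {s \<in> space ?E. escape t m ?\<Lambda> (j * R) z s}" for z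
  proof (rule independent_if_local[OF pred_good pred_escape local_in_good])
    \<comment> \<open>This is where \<open>4 * m + 1\<close> is used: vertices at distance at least
      \<open>R\<close> from \<open>x\<close> read only what is farther than \<open>2 * m\<close>
      from \<open>x\<close>.\<close>
    show "local_in {w. int (2 * m) < sup_dist x w} (escape t m ?\<Lambda> (j * R) z)"
    proof (rule local_in_escape, safe)
      fix v w assume "int R \<le> sup_dist x v" "sup_dist v w \<le> int (2 * m)"
      then show "int (2 * m) < sup_dist x w"
        using sup_dist_triangle[of x v w] sup_dist_commute[of w v] R by simp
    qed
  qed auto
  have step: "measure ?E {s \<in> space ?E. good t m x s \<and> escape t m ?\<Lambda> (j * R) z s} \<le> p * ?q ^ j" for z
  proof -
    \<comment> \<open>Once independence has been used, dropping the confinement returns to the event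
      of the induction hypothesis, which is available at every starting vertex.\<close>
    have "measure ?E {s \<in> space ?E. escape t m ?\<Lambda> (j * R) z s} \<le> measure ?E {s \<in> space ?E. escape t m UNIV (j * R) z s}"
      using escape_mono[of t m ?\<Lambda> "j * R" z _ UNIV "j * R"]
      by (intro E.finite_measure_mono sets pred_escape) auto
    also have "\<dots> \<le> ?q ^ j"
      by (rule Suc.IH)
    finally show ?thesis
      unfolding indep by (intro mult_mono p p0 measure_nonneg)
  qed
  have "measure ?E {s \<in> space ?E. escape t m UNIV (Suc j * R) x s} \<le>
      measure ?E (\<Union>z\<in>?S. {s \<in> space ?E. good t m x s \<and> escape t m ?\<Lambda> (j * R) z s})"
  proof (rule E.finite_measure_mono)
    show "{s \<in> space ?E. escape t m UNIV (Suc j * R) x s} \<subseteq>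
        (\<Union>z\<in>?S. {s \<in> space ?E. good t m x s \<and> escape t m ?\<Lambda> (j * R) z s})"
    proof
      fix s assume s: "s \<in> {s \<in> space ?E. escape t m UNIV (Suc j * R) x s}"
      then have "escape t m UNIV (R + j * R) x s"
        by simp
      moreover have "0 < R"
        using R by simp
      ultimately show "s \<in> (\<Union>z\<in>?S. {s \<in> space ?E. good t m x s \<and> escape t m ?\<Lambda> (j * R) z s})"
        using escape_decompose[of t m R "j * R" x s] s by blast
    qed
  qed (intro sets.finite_UN finS sets pred_intros_logic pred_good pred_escape)
  also have "\<dots> \<le> (\<Sum>z\<in>?S. measure ?E {s \<in> space ?E. good t m x s \<and> escape t m ?\<Lambda> (j * R) z s})"
    by (intro E.finite_measure_subadditive_finite finS image_subsetI sets pred_intros_logic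
        pred_good pred_escape)
  also have "\<dots> \<le> (\<Sum>z\<in>?S. p * ?q ^ j)"
    by (intro sum_mono step)
  also have "\<dots> = real (card ?S) * (p * ?q ^ j)"
    by simp
  also have "\<dots> \<le> real (4 * (2 * R + 1)) * (p * ?q ^ j)"
  proof (rule mult_right_mono)
    show "real (card ?S) \<le> real (4 * (2 * R + 1))"
      using card_sphere_le[of x R] by (simp only: of_nat_le_iff)
    show "0 \<le> p * ?q ^ j"
      using p0 by simp
  qed
  also have "\<dots> = ?q ^ Suc j"
    by simp
  finally show ?case .
qed

subsection \<open>Connection probabilities below the critical time\<close>

lemma connection_prob_nonneg: "0 \<le> connection_prob \<rho> t n"
  by (simp add: connection_prob_def)

lemma connection_prob_le_1: "connection_prob \<rho> t n \<le> 1"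
  unfolding connection_prob_eq by (rule prob_space.prob_le_1[OF prob_space_environment])

lemma connection_prob_antimono: "n' \<le> n \<Longrightarrow> connection_prob \<rho> t n \<le> connection_prob \<rho> t n'"
  unfolding connection_prob_eq using pred_reach[where \<rho> = \<rho> and t = t and n = n' and x = "(0, 0)"] reach_antimono
  by (intro finite_measure.finite_measure_mono prob_space.finite_measure[OF prob_space_environment])
    (auto simp: pred_def)

lemma connection_prob_mono: "t \<le> t' \<Longrightarrow> connection_prob \<rho> t n \<le> connection_prob \<rho> t' n"
  unfolding connection_prob_eq using pred_reach[where \<rho> = \<rho> and t = t' and n = n and x = "(0, 0)"] reach_mono
  by (intro finite_measure.finite_measure_mono prob_space.finite_measure[OF prob_space_environment])
    (auto simp: pred_def)

text \<open>By Tonelli, the sum of the connection probabilities is the expected number of distances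
  reached by the cluster.\<close>

lemma summable_connection_prob:
  assumes "mean_cluster_size \<rho> t < \<infinity>"
  shows "summable (connection_prob \<rho> t)"
proof -
  let ?M = "cdpre \<rho> t"
  define A where "A n = {\<omega> \<in> space ?M. \<exists>x\<in>box_boundary n. open_connected \<omega> (0, 0) x}" for n
  have A[measurable]: "A n \<in> sets ?M" for n
    unfolding A_def cdpre_def space_distr sets_distr by (rule sets_connection)
  interpret M: prob_space ?M
    unfolding cdpre_def by (rule prob_space.prob_space_distr[OF prob_space_environment measurable_cdp_config])
  have "emeasure (count_space UNIV) {n. \<omega> \<in> A n} \<le> emeasure (count_space UNIV) (cluster \<omega>)" for \<omega>
  proof (cases "finite (cluster \<omega>)")
    case True
    have "\<forall>n. \<exists>x. \<omega> \<in> A n \<longrightarrow> x \<in> cluster \<omega> \<and> sup_dist (0, 0) x = int n"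
      by (auto simp: A_def box_boundary_eq_sphere cluster_def)
    then obtain f where f: "\<And>n. \<omega> \<in> A n \<Longrightarrow> f n \<in> cluster \<omega> \<and> sup_dist (0, 0) (f n) = int n"
      unfolding choice_iff by blast
    have inj: "inj_on f {n. \<omega> \<in> A n}"
    proof (rule inj_onI)
      fix i j assume ij: "i \<in> {n. \<omega> \<in> A n}" "j \<in> {n. \<omega> \<in> A n}" "f i = f j"
      have "int i = sup_dist (0, 0) (f i)" "sup_dist (0, 0) (f j) = int j"
        using f ij(1,2) by force+
      then have "int i = int j"
        unfolding ij(3) by (rule trans)
      then show "i = j"
        by (rule of_nat_eq_iff[THEN iffD1])
    qed
    have sub: "f ` {n. \<omega> \<in> A n} \<subseteq> cluster \<omega>"
      using f by blast
    have "finite {n. \<omega> \<in> A n}"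
      using finite_imageD[OF finite_subset[OF sub True] inj] .
    moreover have "card {n. \<omega> \<in> A n} \<le> card (cluster \<omega>)"
      by (rule card_inj_on_le[OF inj sub True])
    ultimately show ?thesis
      using True by (simp add: emeasure_count_space_finite ennreal_of_nat_eq_real_of_nat)
  qed simp
  moreover have "emeasure (count_space UNIV) {n. \<omega> \<in> A n} = (\<Sum>n. indicator (A n) \<omega>)" for \<omega>
  proof -
    have "(\<Sum>n. indicator (A n) \<omega> :: ennreal) = (\<integral>\<^sup>+ n. indicator (A n) \<omega> \<partial>count_space UNIV)"
      by (simp add: nn_integral_count_space_nat)
    also have "\<dots> = (\<integral>\<^sup>+ n. indicator {n. \<omega> \<in> A n} n \<partial>count_space UNIV)"
      by (simp add: indicator_def)
    also have "\<dots> = emeasure (count_space UNIV) {n. \<omega> \<in> A n}"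
      by (rule nn_integral_indicator) simp
    finally show ?thesis ..
  qed
  ultimately have "(\<integral>\<^sup>+ \<omega>. (\<Sum>n. indicator (A n) \<omega>) \<partial>?M) \<le> mean_cluster_size \<rho> t"
    unfolding mean_cluster_size_def by (intro nn_integral_mono) simp
  also have "(\<integral>\<^sup>+ \<omega>. (\<Sum>n. indicator (A n) \<omega>) \<partial>?M) = (\<Sum>n. ennreal (connection_prob \<rho> t n))"
    by (subst nn_integral_suminf) (simp_all add: M.emeasure_eq_measure connection_prob_def A_def[symmetric])
  finally have "(\<Sum>n. ennreal (connection_prob \<rho> t n)) \<noteq> top"
    using assms by (auto simp: top_unique)
  then show ?thesis
    by (rule summable_suminf_not_top[OF connection_prob_nonneg])
qed

section \<open>Boundary cases: time zero and distance one\<close>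

lemma sets_clocks_in:
  assumes "finite J" "J \<subseteq> edges" "X \<in> sets borel"
  shows "{s \<in> space (environment \<rho>). \<forall>e\<in>J. snd s e \<in> X} \<in> sets (environment \<rho>)"
  unfolding pred_def[symmetric]
proof (intro pred_intros_finite assms(1))
  fix e assume "e \<in> J"
  then show "Measurable.pred (environment \<rho>) (\<lambda>s. snd s e \<in> X)"
    using assms by (intro pred_sets2[OF assms(3)] measurable_clock) auto
qed

lemma emeasure_clocks_in:
  assumes "finite J" "J \<subseteq> edges" "X \<in> sets borel"
  shows "emeasure (environment \<rho>) {s \<in> space (environment \<rho>). \<forall>e\<in>J. snd s e \<in> X} =
    emeasure lborel ({0<..1} \<inter> X) ^ card J"
proof -
  interpret C: product_prob_space "\<lambda>_ :: edge. clock_law" edges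
    by (rule product_prob_spaceI) (rule prob_space_clock_law)
  have "{U \<in> space clocks. \<forall>e\<in>J. U e \<in> X} \<in> sets clocks"
    using assms by (intro sets.sets_Collect_finite_All sets_Collect_single) auto
  then have "emeasure (environment \<rho>) {s \<in> space (environment \<rho>). \<forall>e\<in>J. snd s e \<in> X} =
      emeasure clocks {U \<in> space clocks. \<forall>e\<in>J. U e \<in> X}"
    by (rule emeasure_environment_clocks)
  also have "\<dots> = (\<Prod>e\<in>J. emeasure clock_law X)"
    using assms by (intro C.emeasure_PiM_Collect) auto
  also have "emeasure clock_law X = emeasure lborel ({0<..1} \<inter> X)"
    using assms(3) by (subst emeasure_uniform_measure) (simp_all add: divide_ennreal_def)
  finally show ?thesis
    by simp
qed

text \<open>Makes the set in \<open>critical_time\<close> nonempty, so that its supremum is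
  meaningful. Clocks are almost surely positive, so at time 0 the cluster is the origin
  alone.\<close>

lemma mean_cluster_size_0: "mean_cluster_size \<rho> 0 < \<infinity>"
proof -
  interpret M: prob_space "cdpre \<rho> 0"
    unfolding cdpre_def by (rule prob_space.prob_space_distr[OF prob_space_environment measurable_cdp_config])
  have "AE s in environment \<rho>. \<not> snd s e \<le> 0" if "e \<in> edges" for e
  proof (rule AE_I)
    show "emeasure (environment \<rho>) {s \<in> space (environment \<rho>). \<forall>e\<in>{e}. snd s e \<in> {..0}} = 0"
    proof -
      have "{0<..1} \<inter> {..0 :: real} = {}"
        by auto
      then show ?thesis
        using that by (subst emeasure_clocks_in) auto
    qed
    show "{s \<in> space (environment \<rho>). \<forall>e\<in>{e}. snd s e \<in> {..0}} \<in> sets (environment \<rho>)"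
      using that by (intro sets_clocks_in) auto
  qed auto
  then have "AE s in environment \<rho>. \<forall>e\<in>edges. \<not> snd s e \<le> 0"
    by (simp only: AE_ball_countable[OF countable_edges]) blast
  then have "AE s in environment \<rho>. \<forall>e\<in>edges. \<not> cdp_config 0 s e"
    by (rule eventually_mono) (simp add: cdp_config_iff)
  moreover have "{\<omega> \<in> space (PiM edges (\<lambda>_. count_space UNIV)). \<forall>e\<in>edges. \<not> \<omega> e}
      \<in> sets (PiM edges (\<lambda>_. count_space UNIV))"
    unfolding pred_def[symmetric]
    by (intro pred_Ball_edges pred_intros_logic measurable_component_singleton)
  ultimately have "AE \<omega> in cdpre \<rho> 0. \<forall>e\<in>edges. \<not> \<omega> e"
    unfolding cdpre_def by (subst AE_distr_iff[OF measurable_cdp_config])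
  then have "AE \<omega> in cdpre \<rho> 0. emeasure (count_space UNIV) (cluster \<omega>) \<le> 1"
  proof eventually_elim
    case (elim \<omega>)
    then have "{(u, v). {u, v} \<in> edges \<and> \<omega> {u, v}} = {}"
      by auto
    then have "cluster \<omega> = {(0, 0)}"
      unfolding cluster_def open_connected_def by (simp only: rtrancl_empty) auto
    then show ?case
      by simp
  qed
  then have "mean_cluster_size \<rho> 0 \<le> (\<integral>\<^sup>+ \<omega>. 1 \<partial>cdpre \<rho> 0)"
    unfolding mean_cluster_size_def by (rule nn_integral_mono_AE)
  then show ?thesis
    by (simp add: M.emeasure_space_1 order_le_less_trans)
qed

text \<open>With positive probability all clocks at the origin exceed \<open>t\<close>. This
  supplies the exponential bound at short distances.\<close>

lemma connection_prob_1_less: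
  assumes "0 \<le> t" "t < 1"
  shows "connection_prob \<rho> t 1 < 1"
proof -
  let ?E = "environment \<rho>"
  interpret E: prob_space ?E
    by (rule prob_space_environment)
  let ?J = "incident (0, 0)"
  let ?A = "{s \<in> space ?E. \<forall>e\<in>?J. snd s e \<in> {t<..}}"
  have J: "?J \<subseteq> edges"
    by (auto simp: incident_def)
  have sets: "?A \<in> sets ?E"
    by (rule sets_clocks_in[OF finite_incident J]) simp
  have "{0<..1} \<inter> {t<..} = {t<..1}"
    using assms by auto
  then have "emeasure ?E ?A = ennreal (1 - t) ^ card ?J"
    using emeasure_clocks_in[OF finite_incident J, of "{t<..}" \<rho>] assms by simp
  then have pos: "0 < measure ?E ?A"
    using assms by (simp add: measure_def ennreal_power enn2real_positive_iff ennreal_less_top)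
  have "connection_prob \<rho> t 1 \<le> measure ?E (space ?E - ?A)"
    unfolding connection_prob_eq
  proof (rule E.finite_measure_mono)
    show "{s \<in> space ?E. reach t 1 (0, 0) s} \<subseteq> space ?E - ?A"
    proof safe
      fix s assume reach: "reach t 1 (0, 0) s" and all: "\<forall>e\<in>?J. snd s e \<in> {t<..}"
      obtain y where "sup_dist (0, 0) y = 1" "((0, 0), y) \<in> (open_steps t s)\<^sup>*"
        using reach unfolding reach_def open_connected_iff by auto
      then obtain z where "((0, 0), z) \<in> open_steps t s"
        by (auto elim: converse_rtranclE)
      then have "{(0, 0), z} \<in> ?J" "snd s {(0, 0), z} \<le> t"
        by (simp_all add: open_steps_def incident_def)
      with all show False
        by fastforce
    qed
  qed (use sets in auto)
  also have "\<dots> = 1 - measure ?E ?A"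
    by (rule E.prob_compl[OF sets])
  finally show ?thesis
    using pos by simp
qed

lemma exists_contracting_scale:
  assumes "summable (connection_prob \<rho> t)"
  obtains m where "4 * (2 * real (4 * m + 1) + 1) *
    (connection_prob \<rho> t m + 4 * (2 * real m + 1)\<^sup>2 * (8 ^ m / fact (Suc m))) \<le> 1 / 2"
proof -
  let ?\<theta> = "connection_prob \<rho> t"
  define S where "S n = sum ?\<theta> {..<n}" for n
  have S: "S \<longlonglongrightarrow> suminf ?\<theta>"
    unfolding S_def by (rule summable_LIMSEQ[OF assms])
  have "(\<lambda>k. S (2 * k)) \<longlonglongrightarrow> suminf ?\<theta>"
    using LIMSEQ_subseq_LIMSEQ[OF S, of "\<lambda>k. 2 * k"] by (simp add: strict_mono_def comp_def)
  then have "(\<lambda>k. S (2 * k) - S k) \<longlonglongrightarrow> suminf ?\<theta> - suminf ?\<theta>"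
    using S by (rule tendsto_diff)
  moreover have "(\<lambda>k. 64 ^ k / fact k :: real) \<longlonglongrightarrow> 0"
    using summable_LIMSEQ_zero[OF summable_exp[of "64 :: real"]] by (simp add: field_simps)
  then have "(\<lambda>k. 64 ^ (2 * k) / fact (2 * k) :: real) \<longlonglongrightarrow> 0"
    using LIMSEQ_subseq_LIMSEQ[of "\<lambda>k. 64 ^ k / fact k :: real" 0 "\<lambda>k. 2 * k"]
    by (simp add: strict_mono_def comp_def)
  \<comment> \<open>With \<open>m = 2 * k\<close> and \<open>1 \<le> k\<close> the prefactor
    \<open>4 * (8 * m + 3)\<close> is \<open>64 * k + 12\<close>, at most \<open>76 * k\<close>. The
    second term dominates the contribution of chains.\<close>
  ultimately have "(\<lambda>k. 76 * (S (2 * k) - S k) + 512 * (64 ^ (2 * k) / fact (2 * k))) \<longlonglongrightarrow> 76 * (suminf ?\<theta> - suminf ?\<theta>) + 512 * 0"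
    by (intro tendsto_add tendsto_mult tendsto_const)
  then have "(\<lambda>k. 76 * (S (2 * k) - S k) + 512 * (64 ^ (2 * k) / fact (2 * k))) \<longlonglongrightarrow> 0"
    by simp
  then have "\<forall>\<^sub>F k in sequentially. 76 * (S (2 * k) - S k) + 512 * (64 ^ (2 * k) / fact (2 * k)) < 1 / 2"
    by (intro order_tendstoD(2)[where y = 0]) simp_all
  then have "\<forall>\<^sub>F k in sequentially. 76 * (S (2 * k) - S k) + 512 * (64 ^ (2 * k) / fact (2 * k)) < 1 / 2 \<and> 1 \<le> k"
    using eventually_ge_at_top by (rule eventually_conj)
  then obtain k where k: "76 * (S (2 * k) - S k) + 512 * (64 ^ (2 * k) / fact (2 * k)) < 1 / 2" "1 \<le> k"
    using eventually_happens'[OF sequentially_bot] by blast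
  define m where "m = 2 * k"
  \<comment> \<open>Block argument: the \<open>k\<close> terms from \<open>k\<close> to
    \<open>2 * k - 1\<close> are each at least \<open>?\<theta> m\<close>, and their sum is a Cauchy
    difference.\<close>
  have "real k * ?\<theta> m = (\<Sum>j\<in>{k..<2 * k}. ?\<theta> m)"
    by simp
  also have "\<dots> \<le> (\<Sum>j\<in>{k..<2 * k}. ?\<theta> j)"
    unfolding m_def by (intro sum_mono connection_prob_antimono) simp
  also have "\<dots> = S (2 * k) - S k"
    unfolding S_def lessThan_atLeast0 by (rule sum_diff_nat_ivl[symmetric]) simp_all
  finally have "76 * (real k * ?\<theta> m) \<le> 76 * (S (2 * k) - S k)"
    by simp
  moreover have "4 * (2 * real (4 * m + 1) + 1) * ?\<theta> m \<le> 76 * real k * ?\<theta> m"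
    using k(2) by (intro mult_right_mono connection_prob_nonneg) (simp add: m_def)
  moreover have "4 * (2 * real (4 * m + 1) + 1) * (4 * (2 * real m + 1)\<^sup>2 * (8 ^ m / fact (Suc m)))
      \<le> 512 * (64 ^ m / fact m)"
  proof -
    \<comment> \<open>The three factors linear in \<open>m\<close> are dominated by multiples of
      \<open>2 ^ m\<close>, and \<open>8 * 2 ^ 3 = 64\<close> is the new base.\<close>
    define a :: real where "a = 2 ^ m"
    have "m + 1 \<le> 2 ^ m"
      by (induction m) auto
    then have "real (m + 1) \<le> real (2 ^ m)"
      by (simp only: of_nat_le_iff)
    then have a: "real m + 1 \<le> a"
      by (simp add: a_def)
    have "(8 :: real) ^ m / fact (Suc m) \<le> 8 ^ m / fact m"
      by (intro divide_left_mono) (simp_all add: fact_mono del: fact_Suc)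
    moreover have "(2 * real m + 1)\<^sup>2 \<le> (2 * a)\<^sup>2"
      using a by (intro power_mono) simp_all
    moreover have "2 * real (4 * m + 1) + 1 \<le> 8 * a"
      using a by simp
    ultimately have "4 * (2 * real (4 * m + 1) + 1) * (4 * (2 * real m + 1)\<^sup>2 * (8 ^ m / fact (Suc m)))
        \<le> 4 * (8 * a) * (4 * (2 * a)\<^sup>2 * (8 ^ m / fact m))"
      using a by (intro mult_mono order_refl mult_nonneg_nonneg) simp_all
    also have "\<dots> = 512 * (a ^ 3 * 8 ^ m / fact m)"
      by (simp add: power2_eq_square power3_eq_cube)
    also have "a ^ 3 * 8 ^ m = 64 ^ m"
      unfolding a_def by (simp add: power_mult_distrib[symmetric] flip: power_mult)
        (simp add: mult.commute[of m 3] power_mult flip: power_mult_distrib)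
    finally show ?thesis .
  qed
  ultimately have "4 * (2 * real (4 * m + 1) + 1) *
      (?\<theta> m + 4 * (2 * real m + 1)\<^sup>2 * (8 ^ m / fact (Suc m))) \<le> 1 / 2"
    using k(1) unfolding distrib_left m_def by linarith
  then show thesis
    by (rule that)
qed

theorem theorem2:
  fixes \<rho> :: "nat pmf" and t :: real
  assumes "set_pmf \<rho> \<subseteq> {0, 1, 2, 3}"
    and "t \<in> {0..1}"
    and "t < critical_time \<rho>"
  shows "\<exists>\<alpha>>0. \<forall>n. connection_prob \<rho> t n \<le> exp (- \<alpha> * real n)"
proof -
  let ?\<theta> = "connection_prob \<rho> t"
  \<comment> \<open>Nonempty and bounded, the set defining \<open>critical_time\<close> has an
    element \<open>s\<close> above \<open>t\<close>; monotonicity in time carries summability from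
    \<open>s\<close> back to \<open>t\<close>. As \<open>s \<le> 1\<close>, also
    \<open>t < 1\<close>.\<close>
  have "0 \<in> {s \<in> {0..1}. mean_cluster_size \<rho> s < \<infinity>}"
    using mean_cluster_size_0 by simp
  moreover have "bdd_above {s \<in> {0..1}. mean_cluster_size \<rho> s < \<infinity>}"
    by (rule bdd_aboveI[of _ 1]) simp
  ultimately obtain s where s: "s \<in> {0..1}" "mean_cluster_size \<rho> s < \<infinity>" "t < s"
    using assms(3) less_cSup_iff[of "{s \<in> {0..1}. mean_cluster_size \<rho> s < \<infinity>}" t]
    unfolding critical_time_def by blast
  have "summable ?\<theta>"
  proof (rule summable_comparison_test'[OF summable_connection_prob[OF s(2)]])
    show "norm (?\<theta> n) \<le> connection_prob \<rho> s n" for n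
      using connection_prob_mono[of t s] connection_prob_nonneg s(3) by simp
  qed
  then obtain m where m: "4 * (2 * real (4 * m + 1) + 1) *
      (?\<theta> m + 4 * (2 * real m + 1)\<^sup>2 * (8 ^ m / fact (Suc m))) \<le> 1 / 2"
    by (rule exists_contracting_scale)
  define R where "R = 4 * m + 1"
  define q where "q = 4 * (2 * real R + 1) * (?\<theta> m + 4 * (2 * real m + 1)\<^sup>2 * (8 ^ m / fact (Suc m)))"
  have q: "0 \<le> q" "q \<le> 1 / 2"
    using m connection_prob_nonneg by (simp_all add: q_def R_def del: fact_Suc)
  have large: "?\<theta> n \<le> (1 / 2) ^ (n div R)" if "2 * R \<le> n" for n
  proof -
    interpret E: prob_space "environment \<rho>"
      by (rule prob_space_environment)
    have "?\<theta> n \<le> measure (environment \<rho>) {s \<in> space (environment \<rho>). escape t m UNIV (n div R * R) (0, 0) s}"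
      unfolding connection_prob_eq
    proof (rule E.finite_measure_mono)
      show "{s \<in> space (environment \<rho>). reach t n (0, 0) s} \<subseteq>
          {s \<in> space (environment \<rho>). escape t m UNIV (n div R * R) (0, 0) s}"
      proof
        fix s assume s: "s \<in> {s \<in> space (environment \<rho>). reach t n (0, 0) s}"
        then have "escape t m UNIV n (0, 0) s"
          using that by (intro reach_imp_escape) (auto simp: R_def)
        then have "escape t m UNIV (n div R * R) (0, 0) s"
          using escape_mono[OF _ order_refl div_times_less_eq_dividend] by blast
        with s show "s \<in> {s \<in> space (environment \<rho>). escape t m UNIV (n div R * R) (0, 0) s}"
          by simp
      qed
    qed (use pred_escape in \<open>simp add: pred_def\<close>)
    also have "\<dots> \<le> q ^ (n div R)"
      unfolding q_def by (rule measure_escape_le[OF measure_good_le R_def])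
    also have "\<dots> \<le> (1 / 2) ^ (n div R)"
      using q by (intro power_mono)
    finally show ?thesis .
  qed
  \<comment> \<open>An upper bound for all \<open>n \<ge> 1\<close>, used when
    \<open>n < 2 * R\<close>. The maximum with 1/2 keeps \<open>c\<close> positive, as
    \<open>ln c\<close> requires, even if \<open>?\<theta> 1\<close> vanishes.\<close>
  define c where "c = max (?\<theta> 1) (1 / 2)"
  have c: "0 < c" "c < 1"
    using connection_prob_1_less[of t \<rho>] assms(2) s by (auto simp: c_def)
  have R: "0 < real R"
    by (simp add: R_def)
  \<comment> \<open>The second rate keeps the exponential above \<open>c\<close> up to
    \<open>2 * R\<close>. The first turns \<open>(1 / 2) ^ (n div R)\<close> into an exponential in
    \<open>n\<close>, its factor 2 paying for the rounding.\<close>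
  define \<alpha> where "\<alpha> = min (ln 2 / (2 * real R)) (- ln c / (2 * real R))"
  have \<alpha>: "\<alpha> \<le> ln 2 / (2 * real R)" "\<alpha> \<le> - ln c / (2 * real R)" "0 < \<alpha>"
    using c R by (simp_all add: \<alpha>_def divide_neg_pos)
  have "?\<theta> n \<le> exp (- \<alpha> * real n)" for n
  proof -
    consider "n = 0" | "1 \<le> n" "n < 2 * R" | "2 * R \<le> n"
      by linarith
    then show ?thesis
    proof cases
      case 1
      then show ?thesis
        using connection_prob_le_1 by simp
    next
      case 2
      have "\<alpha> * real n \<le> - ln c / (2 * real R) * (2 * real R)"
        using 2 \<alpha> R c by (intro mult_mono) simp_all
      then have "ln c \<le> - \<alpha> * real n"
        using R by simp
      then have "exp (ln c) \<le> exp (- \<alpha> * real n)"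
        by (simp only: exp_le_cancel_iff)
      moreover have "?\<theta> n \<le> c"
        using connection_prob_antimono[OF 2(1), of \<rho> t] by (simp add: c_def)
      ultimately show ?thesis
        using c by simp
    next
      case 3
      have "n < (n div R + 1) * R"
        using R by (simp add: dividend_less_div_times)
      then have "real n < real ((n div R + 1) * R)"
        by (simp only: of_nat_less_iff)
      moreover have "2 * real R \<le> real n"
        using 3 by simp
      \<comment> \<open>From \<open>n < (n div R) * R + R\<close> and \<open>R \<le> n / 2\<close>:
        rounding down loses at most half of \<open>n\<close>.\<close>
      ultimately have "real n \<le> real (n div R) * (2 * real R)"
        by (simp add: algebra_simps)
      then have "\<alpha> * real n \<le> \<alpha> * (real (n div R) * (2 * real R))"
        using \<alpha> by simp
      also have "\<dots> \<le> ln 2 / (2 * real R) * (real (n div R) * (2 * real R))"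
        using \<alpha> by (intro mult_right_mono) simp_all
      also have "\<dots> = real (n div R) * ln 2"
        using R by simp
      finally have "exp (- (real (n div R) * ln 2)) \<le> exp (- \<alpha> * real n)"
        by simp
      moreover have "exp (- (real (n div R) * ln 2)) = (1 / 2) ^ (n div R)"
        by (simp add: exp_minus exp_of_nat_mult power_one_over inverse_eq_divide)
      ultimately show ?thesis
        using large[OF 3] by simp
    qed
  qed
  with \<alpha>(3) show ?thesis
    by blast
qed

end
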